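(* Let $\mathcal{P}$ be a left-basic set operad (finite in each arity, with $\mathcal{P}(0)=\varnothing$ and $\mathcal{P}(1)=\{*\}$). Then the poset species ${}^{\mathcal{P}}\Pi$ of left-$\mathcal{P}$-decorated partitions, equipped with the forgetful morphism $a:{}^{\mathcal{P}}\Pi\to\Pi$, $(\pi,\xi)\mapsto\pi$, and with the morphisms $\varphi_{(\pi,\xi)}$ and $\psi_{(\pi,\xi)}$ described in the context, is an operadic poset species.
   Context: All finite sets $S$ are non-empty. $\Pi(S)$ is the poset of partitions of $S$, with $\alpha\le\beta$ iff $\alpha$ is obtained by merging blocks of $\beta$. For $T\subset S$, $\pi_{|T}$ is the set of blocks of $\pi$ contained in $T$. There are isomorphisms $\varphi_\pi:\Pi_{\le\pi}(S)\to\Pi(\pi)$, $\alpha\mapsto\alpha/\pi:=\{\pi_{|T},T\in\alpha\}$, and $\psi_\pi:\Pi_{\ge\pi}(S)\to\prod_{T\in\pi}\Pi(T)$, $\beta\mapsto(\beta_{|T})_{T\in\pi}$ (a partition is identified with its set of blocks). Left-decorated partitions. A left-$\mathcal{P}$-decorated partition of $S$ is a pair $(\pi,\xi)$ with $\pi\in\Pi(S)$ and $\xi\in\mathcal{P}(\pi)$; ${}^{\mathcal{P}}\Pi(S)$ is the set of those, ordered by: $(\alpha,\xi)\le(\beta,\eta)$ iff $\alpha\le\beta$ and there exist $\mu_T\in\mathcal{P}(\beta_{|T})$ for $T\in\alpha$ such that $\eta=\xi\circ(\mu_T)_{T\in\alpha}$. The operad $\mathcal{P}$ is left-basic if for every finite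 set $S$ and every left-$\mathcal{P}$-decorated partition $(\pi,\xi)$ of $S$, the map $\prod_{T\in\pi}\mathcal{P}(T)\to\mathcal{P}(S)$, $(\mu_T)\mapsto\xi\circ(\mu_T)_{T\in\pi}$ is injective. The morphism $\varphi_{(\pi,\xi)}:{}^{\mathcal{P}}\Pi_{\le(\pi,\xi)}(S)\to{}^{\mathcal{P}}\Pi(\pi)$ sends $(\alpha,\mu)$ to $(\alpha/\pi,\tilde\mu)$, where $\tilde\mu\in\mathcal{P}(\alpha/\pi)$ corresponds to $\mu\in\mathcal{P}(\alpha)$ via the bijection $\alpha\simeq\alpha/\pi$, $T\leftrightarrow\pi_{|T}$. The morphism $\psi_{(\pi,\xi)}:{}^{\mathcal{P}}\Pi_{\ge(\pi,\xi)}(S)\to\prod_{T\in\pi}{}^{\mathcal{P}}\Pi(T)$ sends $(\beta,\eta)$ to $(\beta_{|T},\mu_T)_{T\in\pi}$, where $(\mu_T)_{T\in\pi}$ is the unique family with $\mu_T\in\mathcal{P}(\beta_{|T})$ and $\eta=\xi\circ(\mu_T)_{T\in\pi}$. Operadic poset species. A poset species is a functor from finite sets and bijections to (finite) posets. An operadic poset species is a poset species $P$ with a morphism of poset species $a:P\to\Pi$ such that $a^{-1}(\min\Pi(S))=\min P(S)$ and $a^{-1}(\max\Pi(S))=\max P(S)$ for all $S$ (sets of minimal/maximal elements), and, for all $S$ and $x\in P(S)$ with $a(x)=\pi$, morphisms of posets $\varphi_x:P_{\le x}(S)\to P(\pi)$ and $\psi_x:P_{\ge x}(S)\to\prod_{T\in\pi}P(T)$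 with $a\circ\varphi_x=\varphi_\pi\circ a$ and $a\circ\psi_x=\psi_\pi\circ a$, satisfying: (Equivariance) For a bijection $f:S\to S'$, $x\in P(S)$, $x'=P(f)(x)$, $\pi=a(x)$, $\pi'=a(x')$, and the induced bijections $f:\pi\to\pi'$, $f_{|T}:T\to f(T)$: $P(f)\circ\varphi_x=\varphi_{x'}\circ P(f)$ and $(P(f_{|T}))_{T\in\pi}\circ\psi_x=\psi_{x'}\circ P(f)$. (Unitality) $P(\{s\})$ is a singleton for every singleton $\{s\}$. (Associativity) Let $x\le x'$ in $P(S)$, $\pi=a(x)$, $\pi'=a(x')$, $\underline{x}=\varphi_{x'}(x)\in P(\pi')$, $(x'_{|T})_{T\in\pi}=\psi_x(x')$; identify $\pi$ with the partition $\{\pi'_{|T},T\in\pi\}$ of $\pi'$. Then $\varphi_{\underline{x}}\circ\varphi_{x'}=\varphi_x$ on $P_{\le x}(S)$; $(\psi_{x'_{|T}})_{T\in\pi}\circ\psi_x=\psi_{x'}$ on $P_{\ge x'}(S)$; and $\psi_{\underline{x}}\circ\varphi_{x'}=(\varphi_{x'_{|T}})_{T\in\pi}\circ\psi_x$ as maps $P_{[x,x']}(S)\to\prod_{T\in\pi}P(\pi'_{|T})$.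
   Formalization: The formal theorem additionally assumes that P(S) is non-empty for every non-empty finite set S; otherwise the condition on maximal elements fails, e.g. for P(1)={*} and P(n) empty for n ≥ 2. *)

theory Defs
  imports "HOL-Library.FSet" "HOL-Library.FuncSet" "HOL-Library.Disjoint_Sets"
begin

text \<open>
  Species have to be evaluated at a finite set \<open>S\<close>, at partitions of \<open>S\<close>, at partitions of
  partitions of \<open>S\<close>, and so on. We therefore work in the universe \<open>'a hf\<close> of hereditarily finite
  sets over an arbitrary type \<open>'a\<close> of atoms: a finite set is a finite subset \<open>S :: 'a hf set\<close>, and
  every finite set of elements of the universe has a code, which is again an element of the
  universe. Finite subsets of the universe and bijections between them form a category equivalent
  to that of all finite sets and bijections. The convention that finite sets are non-empty
  is the predicate \<open>fin\<close>.
\<close>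

datatype 'a hf = Atom 'a | FinSet "'a hf fset"

definition enc :: "'a hf set \<Rightarrow> 'a hf" where
  "enc X = FinSet (Abs_fset X)"

text \<open>The value of \<open>dec\<close> on atoms is irrelevant.\<close>

primrec dec :: "'a hf \<Rightarrow> 'a hf set" where
  "dec (Atom a) = {}"
| "dec (FinSet X) = fset X"

lemma dec_enc: "finite X \<Longrightarrow> dec (enc X) = X"
  by (simp add: enc_def Abs_fset_inverse)

definition fin :: "'b set \<Rightarrow> bool" where
  "fin S \<longleftrightarrow> finite S \<and> S \<noteq> {}"

text \<open>
  A partition \<open>\<pi>\<close> of \<open>S\<close> is a set of sets, as in \<^const>\<open>partition_on\<close>. \<open>Ob \<pi>\<close> is \<open>\<pi>\<close> seen as
  a finite set, its elements being the (codes of the) blocks. A map \<open>F\<close> defined on the blocks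
  of \<open>\<pi>\<close> is seen as the map \<open>on_Ob F\<close> on \<open>Ob \<pi>\<close>, sending \<open>T\<close> to (the code of) \<open>F T\<close>.
\<close>

definition Ob :: "'a hf set set \<Rightarrow> 'a hf set" where
  "Ob \<pi> = enc ` \<pi>"

definition on_Ob :: "('a hf set \<Rightarrow> 'a hf set) \<Rightarrow> 'a hf \<Rightarrow> 'a hf" where
  "on_Ob F = (\<lambda>u. enc (F (dec u)))"

definition restr :: "'b set set \<Rightarrow> 'b set \<Rightarrow> 'b set set" where
  "restr \<pi> T = {B \<in> \<pi>. B \<subseteq> T}"

definition quot :: "'a hf set set \<Rightarrow> 'a hf set set \<Rightarrow> 'a hf set set" where
  "quot \<alpha> \<pi> = (\<lambda>T. Ob (restr \<pi> T)) ` \<alpha>"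

section \<open>Species and poset species\<close>

text \<open>
  \<open>act P S f\<close> is the image under the species \<open>P\<close> of a bijection \<open>f\<close> from \<open>S\<close> to \<open>f ` S\<close>; by
  \<open>act_cong\<close> it depends on the values of \<open>f\<close> on \<open>S\<close> only.
\<close>

record ('u, 'x) species_data =
  carr :: "'u set \<Rightarrow> 'x set"
  act :: "'u set \<Rightarrow> ('u \<Rightarrow> 'u) \<Rightarrow> 'x \<Rightarrow> 'x"

locale species =
  fixes P :: "('u, 'x, 'm) species_data_scheme"
  assumes act_in: "fin S \<Longrightarrow> bij_betw f S S' \<Longrightarrow> x \<in> carr P S \<Longrightarrow> act P S f x \<in> carr P S'"
    and act_cong: "fin S \<Longrightarrow> inj_on f S \<Longrightarrow> (\<And>s. s \<in> S \<Longrightarrow> f s = g s) \<Longrightarrow> x \<in> carr P S \<Longrightarrow>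
      act P S f x = act P S g x"
    and act_id: "fin S \<Longrightarrow> x \<in> carr P S \<Longrightarrow> act P S (\<lambda>s. s) x = x"
    and act_comp: "fin S \<Longrightarrow> bij_betw f S S' \<Longrightarrow> bij_betw g S' S'' \<Longrightarrow> x \<in> carr P S \<Longrightarrow>
      act P S (g \<circ> f) x = act P S' g (act P S f x)"

record ('u, 'x) poset_species_data = "('u, 'x) species_data" +
  le :: "'u set \<Rightarrow> 'x \<Rightarrow> 'x \<Rightarrow> bool"

definition finite_poset :: "'x set \<Rightarrow> ('x \<Rightarrow> 'x \<Rightarrow> bool) \<Rightarrow> bool" where
  "finite_poset A r \<longleftrightarrow> finite A \<and> reflp_on A r \<and> antisymp_on A r \<and> transp_on A r"

definition minimal_elts :: "'x set \<Rightarrow> ('x \<Rightarrow> 'x \<Rightarrow> bool) \<Rightarrow> 'x set" where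
  "minimal_elts A r = {x \<in> A. \<forall>y\<in>A. r y x \<longrightarrow> y = x}"

definition maximal_elts :: "'x set \<Rightarrow> ('x \<Rightarrow> 'x \<Rightarrow> bool) \<Rightarrow> 'x set" where
  "maximal_elts A r = {x \<in> A. \<forall>y\<in>A. r x y \<longrightarrow> y = x}"

locale poset_species = species P
  for P :: "('u, 'x, 'm) poset_species_data_scheme" +
  assumes poset: "fin S \<Longrightarrow> finite_poset (carr P S) (le P S)"
    and act_mono: "fin S \<Longrightarrow> bij_betw f S S' \<Longrightarrow>
      monotone_on (carr P S) (le P S) (le P S') (act P S f)"

definition poset_species_morphism ::
  "('u, 'x, 'm) poset_species_data_scheme \<Rightarrow> ('u, 'y, 'n) poset_species_data_scheme \<Rightarrow>
   ('u set \<Rightarrow> 'x \<Rightarrow> 'y) \<Rightarrow> bool" where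
  "poset_species_morphism P Q a \<longleftrightarrow>
     (\<forall>S. fin S \<longrightarrow> a S \<in> carr P S \<rightarrow> carr Q S \<and> monotone_on (carr P S) (le P S) (le Q S) (a S)) \<and>
     (\<forall>S S' f x. fin S \<longrightarrow> bij_betw f S S' \<longrightarrow> x \<in> carr P S \<longrightarrow>
        a S' (act P S f x) = act Q S f (a S x))"

text \<open>In the poset species of partitions, \<open>\<alpha> \<le> \<beta>\<close> means that \<open>\<alpha>\<close> is coarser than \<open>\<beta>\<close>.\<close>

definition Part :: "('u, 'u set set) poset_species_data" where
  "Part = \<lparr> carr = (\<lambda>S. {\<pi>. partition_on S \<pi>}),
            act = (\<lambda>S f \<pi>. (`) f ` \<pi>),
            le = (\<lambda>S \<alpha> \<beta>. refines S \<beta> \<alpha>) \<rparr>"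

section \<open>Operadic poset species\<close>

definition below :: "('u, 'x, 'm) poset_species_data_scheme \<Rightarrow> 'u set \<Rightarrow> 'x \<Rightarrow> 'x set" where
  "below P S x = {y \<in> carr P S. le P S y x}"

definition above :: "('u, 'x, 'm) poset_species_data_scheme \<Rightarrow> 'u set \<Rightarrow> 'x \<Rightarrow> 'x set" where
  "above P S x = {y \<in> carr P S. le P S x y}"

text \<open>
  The maps \<open>\<phi>\<^sub>x\<close> and \<open>\<psi>\<^sub>x\<close>, for \<open>x \<in> P(S)\<close>, are \<open>\<phi> S x\<close> and \<open>\<psi> S x\<close>; elements of
  a product over the blocks of \<open>\<pi> = a S x\<close> are extensional functions on \<open>\<pi>\<close>.
  In \<open>assoc_\<phi>\<phi>\<close> and \<open>assoc_\<psi>\<phi>\<close> the identification of \<open>\<pi>\<close> with the partition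
  \<open>quot \<pi> \<pi>'\<close> of \<open>Ob \<pi>'\<close>, under which \<open>T\<close> corresponds to \<open>Ob (restr \<pi>' T)\<close>, is made explicit.
\<close>

locale operadic_poset_species = poset_species P
  for P :: "('a hf, 'x, 'm) poset_species_data_scheme"
    and a :: "'a hf set \<Rightarrow> 'x \<Rightarrow> 'a hf set set"
    and \<phi> :: "'a hf set \<Rightarrow> 'x \<Rightarrow> 'x \<Rightarrow> 'x"
    and \<psi> :: "'a hf set \<Rightarrow> 'x \<Rightarrow> 'x \<Rightarrow> 'a hf set \<Rightarrow> 'x" +
  assumes a_morphism: "poset_species_morphism P Part a"
    and a_min: "fin S \<Longrightarrow>
      {x \<in> carr P S. a S x \<in> minimal_elts (carr Part S) (le Part S)} =
      minimal_elts (carr P S) (le P S)"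
    and a_max: "fin S \<Longrightarrow>
      {x \<in> carr P S. a S x \<in> maximal_elts (carr Part S) (le Part S)} =
      maximal_elts (carr P S) (le P S)"
    and \<phi>_in: "fin S \<Longrightarrow> x \<in> carr P S \<Longrightarrow> \<phi> S x \<in> below P S x \<rightarrow> carr P (Ob (a S x))"
    and \<phi>_mono: "fin S \<Longrightarrow> x \<in> carr P S \<Longrightarrow>
      monotone_on (below P S x) (le P S) (le P (Ob (a S x))) (\<phi> S x)"
    and \<psi>_in: "fin S \<Longrightarrow> x \<in> carr P S \<Longrightarrow> \<psi> S x \<in> above P S x \<rightarrow> (\<Pi>\<^sub>E T\<in>a S x. carr P T)"
    and \<psi>_mono: "fin S \<Longrightarrow> x \<in> carr P S \<Longrightarrow>
      monotone_on (above P S x) (le P S) (\<lambda>u v. \<forall>T\<in>a S x. le P T (u T) (v T)) (\<psi> S x)"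
    and a_\<phi>: "fin S \<Longrightarrow> x \<in> carr P S \<Longrightarrow> y \<in> below P S x \<Longrightarrow>
      a (Ob (a S x)) (\<phi> S x y) = quot (a S y) (a S x)"
    and a_\<psi>: "fin S \<Longrightarrow> x \<in> carr P S \<Longrightarrow> y \<in> above P S x \<Longrightarrow> T \<in> a S x \<Longrightarrow>
      a T (\<psi> S x y T) = restr (a S y) T"
    and equivariance_\<phi>: "fin S \<Longrightarrow> bij_betw f S S' \<Longrightarrow> x \<in> carr P S \<Longrightarrow> y \<in> below P S x \<Longrightarrow>
      act P (Ob (a S x)) (on_Ob ((`) f)) (\<phi> S x y) = \<phi> S' (act P S f x) (act P S f y)"
    and equivariance_\<psi>: "fin S \<Longrightarrow> bij_betw f S S' \<Longrightarrow> x \<in> carr P S \<Longrightarrow> y \<in> above P S x \<Longrightarrow>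
      T \<in> a S x \<Longrightarrow> act P T f (\<psi> S x y T) = \<psi> S' (act P S f x) (act P S f y) (f ` T)"
    and unitality: "is_singleton (carr P {s})"
    and assoc_\<phi>\<phi>: "fin S \<Longrightarrow> x \<in> carr P S \<Longrightarrow> x' \<in> carr P S \<Longrightarrow> le P S x x' \<Longrightarrow>
      y \<in> below P S x \<Longrightarrow>
      \<phi> (Ob (a S x')) (\<phi> S x' x) (\<phi> S x' y) =
      act P (Ob (a S x)) (on_Ob (\<lambda>T. Ob (restr (a S x') T))) (\<phi> S x y)"
    and assoc_\<psi>\<psi>: "fin S \<Longrightarrow> x \<in> carr P S \<Longrightarrow> x' \<in> carr P S \<Longrightarrow> le P S x x' \<Longrightarrow>
      y \<in> above P S x' \<Longrightarrow> T \<in> a S x \<Longrightarrow> V \<in> restr (a S x') T \<Longrightarrow>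
      \<psi> T (\<psi> S x x' T) (\<psi> S x y T) V = \<psi> S x' y V"
    and assoc_\<psi>\<phi>: "fin S \<Longrightarrow> x \<in> carr P S \<Longrightarrow> x' \<in> carr P S \<Longrightarrow> le P S x x' \<Longrightarrow>
      y \<in> above P S x \<Longrightarrow> y \<in> below P S x' \<Longrightarrow> T \<in> a S x \<Longrightarrow>
      \<psi> (Ob (a S x')) (\<phi> S x' x) (\<phi> S x' y) (Ob (restr (a S x') T)) =
      \<phi> T (\<psi> S x x' T) (\<psi> S x y T)"

section \<open>Set operads\<close>

text \<open>
  A set operad is a monoid in species of sets for the composition of species, i.e. a species \<open>P\<close>
  with composition maps from \<open>P(\<pi>) \<times> (\<Prod>T\<in>\<pi>. P(T))\<close> to \<open>P(S)\<close>, for all partitions \<open>\<pi>\<close>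
  of \<open>S\<close>, and units in \<open>P({s})\<close>. Partitions into non-empty blocks suffice since only operads with
  nothing in arity 0 are considered. \<open>comp P \<pi> \<xi> \<mu>\<close> is the composite \<open>\<xi> \<circ> (\<mu> T)\<^sub>T\<close>.
\<close>

record ('u, 'o) operad_data = "('u, 'o) species_data" +
  unit :: "'u \<Rightarrow> 'o"
  comp :: "'u set set \<Rightarrow> 'o \<Rightarrow> ('u set \<Rightarrow> 'o) \<Rightarrow> 'o"

text \<open>
  For \<open>\<alpha> \<le> \<beta>\<close>, \<open>\<xi> \<in> P(\<alpha>)\<close> and \<open>\<mu> T \<in> P(restr \<beta> T)\<close> for \<open>T \<in> \<alpha>\<close>, the composite
  \<open>\<xi> \<circ> (\<mu> T)\<^sub>T\<close> lies in \<open>P(\<beta>)\<close>. It is taken along the partition \<open>quot \<alpha> \<beta>\<close> of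
  \<open>Ob \<beta>\<close>, after transporting along the bijection from \<open>\<alpha>\<close> to \<open>quot \<alpha> \<beta>\<close> that sends \<open>T\<close> to
  \<open>U = Ob (restr \<beta> T)\<close>; conversely, \<open>T\<close> is the union of the blocks whose codes are in \<open>U\<close>.
\<close>

definition comp_over :: "('a hf, 'o, 'm) operad_data_scheme \<Rightarrow> 'a hf set set \<Rightarrow> 'a hf set set \<Rightarrow>
    'o \<Rightarrow> ('a hf set \<Rightarrow> 'o) \<Rightarrow> 'o" where
  "comp_over P \<alpha> \<beta> \<xi> \<mu> =
     comp P (quot \<alpha> \<beta>) (act P (Ob \<alpha>) (on_Ob (\<lambda>T. Ob (restr \<beta> T))) \<xi>)
       (\<lambda>U\<in>quot \<alpha> \<beta>. \<mu> (\<Union>(dec ` U)))"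

locale set_operad = species P
  for P :: "('a hf, 'o, 'm) operad_data_scheme" +
  assumes comp_in: "fin S \<Longrightarrow> partition_on S \<pi> \<Longrightarrow> \<xi> \<in> carr P (Ob \<pi>) \<Longrightarrow>
      \<mu> \<in> (\<Pi>\<^sub>E T\<in>\<pi>. carr P T) \<Longrightarrow> comp P \<pi> \<xi> \<mu> \<in> carr P S"
    and comp_natural: "fin S \<Longrightarrow> bij_betw f S S' \<Longrightarrow> partition_on S \<pi> \<Longrightarrow> \<xi> \<in> carr P (Ob \<pi>) \<Longrightarrow>
      \<mu> \<in> (\<Pi>\<^sub>E T\<in>\<pi>. carr P T) \<Longrightarrow>
      act P S f (comp P \<pi> \<xi> \<mu>) =
      comp P ((`) f ` \<pi>) (act P (Ob \<pi>) (on_Ob ((`) f)) \<xi>)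
        (\<lambda>T'\<in>(`) f ` \<pi>. act P (f -` T' \<inter> S) f (\<mu> (f -` T' \<inter> S)))"
    and comp_assoc: "fin S \<Longrightarrow> partition_on S \<alpha> \<Longrightarrow> partition_on S \<beta> \<Longrightarrow> refines S \<beta> \<alpha> \<Longrightarrow>
      \<xi> \<in> carr P (Ob \<alpha>) \<Longrightarrow> \<mu> \<in> (\<Pi>\<^sub>E T\<in>\<alpha>. carr P (Ob (restr \<beta> T))) \<Longrightarrow>
      \<nu> \<in> (\<Pi>\<^sub>E V\<in>\<beta>. carr P V) \<Longrightarrow>
      comp P \<alpha> \<xi> (\<lambda>T\<in>\<alpha>. comp P (restr \<beta> T) (\<mu> T) (restrict \<nu> (restr \<beta> T))) =
      comp P \<beta> (comp_over P \<alpha> \<beta> \<xi> \<mu>) \<nu>"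
    and unit_in: "unit P s \<in> carr P {s}"
    and unit_natural: "act P {s} f (unit P s) = unit P (f s)"
    and unit_left: "fin S \<Longrightarrow> \<xi> \<in> carr P S \<Longrightarrow> comp P {S} (unit P (enc S)) (\<lambda>T\<in>{S}. \<xi>) = \<xi>"
    and unit_right: "fin S \<Longrightarrow> \<xi> \<in> carr P S \<Longrightarrow>
      comp P ((\<lambda>s. {s}) ` S) (act P S (\<lambda>s. enc {s}) \<xi>)
        (\<lambda>T\<in>(\<lambda>s. {s}) ` S. unit P (the_elem T)) = \<xi>"

definition left_basic :: "('a hf, 'o, 'm) operad_data_scheme \<Rightarrow> bool" where
  "left_basic P \<longleftrightarrow> (\<forall>S \<pi> \<xi>. fin S \<longrightarrow> partition_on S \<pi> \<longrightarrow> \<xi> \<in> carr P (Ob \<pi>) \<longrightarrow>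
     inj_on (comp P \<pi> \<xi>) (\<Pi>\<^sub>E T\<in>\<pi>. carr P T))"

section \<open>Left-decorated partitions\<close>

text \<open>
  If \<open>P(S)\<close> is empty for some (non-empty) \<open>S\<close>, then \<open>a_max\<close> fails at \<open>S\<close>: the finite poset of
  left-decorated partitions of \<open>S\<close> contains \<open>({S}, unit)\<close>, hence has a maximal element, but no
  element over the partition of \<open>S\<close> into singletons. So \<open>left_dec P\<close> can only be an operadic poset
  species if \<open>P\<close> is non-empty in every positive arity.
\<close>

definition left_dec :: "('a hf, 'o, 'm) operad_data_scheme \<Rightarrow>
    ('a hf, 'a hf set set \<times> 'o) poset_species_data" where
  "left_dec P =
     \<lparr> carr = (\<lambda>S. {(\<pi>, \<xi>). partition_on S \<pi> \<and> \<xi> \<in> carr P (Ob \<pi>)}),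
       act = (\<lambda>S f (\<pi>, \<xi>). ((`) f ` \<pi>, act P (Ob \<pi>) (on_Ob ((`) f)) \<xi>)),
       le = (\<lambda>S (\<alpha>, \<xi>) (\<beta>, \<eta>). le Part S \<alpha> \<beta> \<and>
         (\<exists>\<mu> \<in> (\<Pi>\<^sub>E T\<in>\<alpha>. carr P (Ob (restr \<beta> T))). \<eta> = comp_over P \<alpha> \<beta> \<xi> \<mu>)) \<rparr>"

definition left_dec_phi :: "('a hf, 'o, 'm) operad_data_scheme \<Rightarrow> 'a hf set \<Rightarrow>
    'a hf set set \<times> 'o \<Rightarrow> 'a hf set set \<times> 'o \<Rightarrow> 'a hf set set \<times> 'o" where
  "left_dec_phi P S = (\<lambda>(\<pi>, \<xi>) (\<alpha>, \<mu>).
     (quot \<alpha> \<pi>, act P (Ob \<alpha>) (on_Ob (\<lambda>T. Ob (restr \<pi> T))) \<mu>))"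

definition left_dec_psi :: "('a hf, 'o, 'm) operad_data_scheme \<Rightarrow> 'a hf set \<Rightarrow>
    'a hf set set \<times> 'o \<Rightarrow> 'a hf set set \<times> 'o \<Rightarrow> 'a hf set \<Rightarrow> 'a hf set set \<times> 'o" where
  "left_dec_psi P S = (\<lambda>(\<pi>, \<xi>) (\<beta>, \<eta>).
     let \<mu> = (THE \<mu>. \<mu> \<in> (\<Pi>\<^sub>E T\<in>\<pi>. carr P (Ob (restr \<beta> T))) \<and> \<eta> = comp_over P \<pi> \<beta> \<xi> \<mu>)
     in (\<lambda>T\<in>\<pi>. (restr \<beta> T, \<mu> T)))"

end

theory Submission
  imports Defs
begin

text \<open>
  Everything rests on one operation, the composite \<open>\<xi> \<circ> (\<mu>\<^sub>T)\<^sub>T\<close> in \<open>P(\<beta>)\<close> for \<open>\<alpha> \<le> \<beta>\<close>.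
  Its unit laws give reflexivity and antisymmetry of the order, and show that the element over the
  coarsest partition is least and that the elements over the finest one are maximal. Its
  associativity gives transitivity, and says that for \<open>x \<le> x' \<le> y\<close> the family \<open>\<psi>\<^sub>x(y)\<close> is
  obtained by composing \<open>\<psi>\<^sub>x(x')\<close> with \<open>\<psi>\<^sub>x\<^sub>'(y)\<close>. Its naturality, applied to the bijections
  induced by \<open>f\<close> on blocks and to the identifications of \<open>\<alpha>\<close> with \<open>\<alpha>/\<pi>\<close>, gives the
  equivariance of \<open>\<psi>\<close> and its compatibility with \<open>\<phi>\<close>. Left-basicness makes the family
  \<open>(\<mu>\<^sub>T)\<close> unique, so that each identity for \<open>\<psi>\<close> is checked by exhibiting one such family.
\<close>

section \<open>Partitions and their codes\<close>

text \<open>The obstacle is bookkeeping. The operad axioms see blocks only through codes, so an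
  iterated composite lives on codes of sets of codes, and the operad laws for
  \<open>comp_over\<close> hold only after identifying such sets. Each composite is therefore
  rewritten as \<open>family_comp\<close>, whose blocks are labelled by an arbitrary finite index
  set: there reindexing and naturality absorb the identifications, and the equation
  \<open>comp_over_eq_family_comp\<close> carries the results back. The identifications that remain
  visible match the blocks of two nested partitions; transport is proved for all such maps at once,
  so equivariance of \<psi> and its interchange with \<phi> have the same proof. The other
  hypotheses enter at isolated points. Triviality of P(1) turns a comparison over a fixed partition
  into an equality, hence antisymmetry. Non-emptiness lets every decorated partition be refined down
  to singletons. Finiteness of each arity makes the posets finite. The maps \<phi> are pure
  relabellings, so left-basicness concerns only \<psi>.\<close>

lemma inj_on_enc: "(\<And>T. T \<in> A \<Longrightarrow> finite T) \<Longrightarrow> inj_on enc A"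
  by (metis dec_enc inj_onI)

lemma dec_image_enc: "(\<And>T. T \<in> A \<Longrightarrow> finite T) \<Longrightarrow> dec ` enc ` A = A"
  by (force simp: image_iff dec_enc)

lemma on_Ob_enc: "finite T \<Longrightarrow> on_Ob h (enc T) = enc (h T)"
  by (simp add: on_Ob_def dec_enc)

lemma on_Ob_image_Ob: "(\<And>T. T \<in> \<alpha> \<Longrightarrow> finite T) \<Longrightarrow> on_Ob h ` Ob \<alpha> = Ob (h ` \<alpha>)"
  by (auto simp: Ob_def on_Ob_enc image_image)

text \<open>Finiteness is needed on both sides: \<open>dec\<close> undoes \<open>enc\<close> only on
  codes of finite sets, and the codes of the images must be told apart as well.\<close>

lemma bij_betw_on_Ob:
  assumes "\<And>T. T \<in> \<alpha> \<Longrightarrow> finite T" "\<And>T. T \<in> \<alpha>' \<Longrightarrow> finite T" "bij_betw h \<alpha> \<alpha>'"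
  shows "bij_betw (on_Ob h) (Ob \<alpha>) (Ob \<alpha>')"
proof -
  have "h ` \<alpha> = \<alpha>'" "inj_on h \<alpha>"
    using assms(3) by (auto simp: bij_betw_def)
  have "inj_on (on_Ob h) (Ob \<alpha>)"
  proof (rule inj_onI)
    fix u v assume "u \<in> Ob \<alpha>" "v \<in> Ob \<alpha>" and eq: "on_Ob h u = on_Ob h v"
    then obtain T T' where T: "T \<in> \<alpha>" "T' \<in> \<alpha>" "u = enc T" "v = enc T'"
      by (auto simp: Ob_def)
    with eq assms have "h T = h T'"
      by (metis \<open>h ` \<alpha> = \<alpha>'\<close> dec_enc imageI on_Ob_enc)
    with T \<open>inj_on h \<alpha>\<close> show "u = v" by (auto dest: inj_onD)
  qed
  then show ?thesis
    using on_Ob_image_Ob[of \<alpha> h] assms(1) \<open>h ` \<alpha> = \<alpha>'\<close> by (simp add: bij_betw_def)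
qed

lemma fin_block: "fin S \<Longrightarrow> partition_on S \<pi> \<Longrightarrow> T \<in> \<pi> \<Longrightarrow> fin T"
  unfolding fin_def partition_on_def by (auto intro: finite_subset)

lemma finite_block: "fin S \<Longrightarrow> partition_on S \<pi> \<Longrightarrow> T \<in> \<pi> \<Longrightarrow> finite T"
  using fin_block fin_def by blast

lemma fin_partition: "fin S \<Longrightarrow> partition_on S \<pi> \<Longrightarrow> fin \<pi>"
  using finite_elements partition_onD1 unfolding fin_def by fastforce

lemma fin_Ob: "fin \<pi> \<Longrightarrow> fin (Ob \<pi>)"
  by (simp add: fin_def Ob_def)

lemma fin_Ob_partition: "fin S \<Longrightarrow> partition_on S \<pi> \<Longrightarrow> fin (Ob \<pi>)"
  using fin_partition fin_Ob by blast

lemma partition_on_unique: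
  "partition_on S \<pi> \<Longrightarrow> T \<in> \<pi> \<Longrightarrow> T' \<in> \<pi> \<Longrightarrow> s \<in> T \<Longrightarrow> s \<in> T' \<Longrightarrow> T = T'"
  unfolding partition_on_def disjoint_def by blast

section \<open>Restriction of a partition to a block\<close>

lemma partition_on_restr: "refines S \<beta> \<alpha> \<Longrightarrow> T \<in> \<alpha> \<Longrightarrow> partition_on T (restr \<beta> T)"
  unfolding restr_def by (rule refines_obtains_subset)

lemma Union_restr: "refines S \<beta> \<alpha> \<Longrightarrow> T \<in> \<alpha> \<Longrightarrow> \<Union> (restr \<beta> T) = T"
  using partition_on_restr partition_onD1 by blast

lemma fin_restr:
  "fin S \<Longrightarrow> refines S \<beta> \<alpha> \<Longrightarrow> T \<in> \<alpha> \<Longrightarrow> fin (restr \<beta> T)"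
  by (metis fin_block fin_partition partition_on_restr refines_def)

lemma restr_restr: "V \<subseteq> T \<Longrightarrow> restr (restr \<gamma> T) V = restr \<gamma> V"
  by (auto simp: restr_def)

lemma restr_self:
  assumes "partition_on S \<pi>" "T \<in> \<pi>"
  shows "restr \<pi> T = {T}"
proof -
  have "B = T" if "B \<in> \<pi>" "B \<subseteq> T" for B
  proof -
    have "B \<noteq> {}" using that(1) assms(1) by (auto simp: partition_on_def)
    then show ?thesis using partition_on_unique[OF assms(1)] that assms(2) by blast
  qed
  then show ?thesis using assms(2) by (auto simp: restr_def)
qed

lemma restr_whole: "partition_on S \<pi> \<Longrightarrow> restr \<pi> S = \<pi>"
  by (auto simp: restr_def partition_on_def)

text \<open>A block of \<gamma> inside T lies in a block of \<beta>, which lies in some block of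
  \<alpha>; since blocks are non-empty, the latter can only be T.\<close>

lemma refines_restr:
  assumes "refines S \<beta> \<alpha>" "refines S \<gamma> \<beta>" "T \<in> \<alpha>"
  shows "refines T (restr \<gamma> T) (restr \<beta> T)"
proof -
  have "refines S \<gamma> \<alpha>" using assms refines_trans by blast
  moreover have "\<exists>B\<in>restr \<beta> T. C \<subseteq> B" if "C \<in> restr \<gamma> T" for C
  proof -
    from that obtain B where B: "B \<in> \<beta>" "C \<subseteq> B" using assms(2) by (auto simp: restr_def refines_def)
    then obtain T' where T': "T' \<in> \<alpha>" "B \<subseteq> T'" using assms(1) by (auto simp: refines_def)
    have "C \<subseteq> T" "C \<noteq> {}" using that assms(2) by (auto simp: restr_def refines_def partition_on_def)
    then have "T = T'" using B T' assms partition_on_unique[of S \<alpha> T T'] by (auto simp: refines_def)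
    then show ?thesis using B T' by (auto simp: restr_def)
  qed
  ultimately show ?thesis
    using assms partition_on_restr[of S _ \<alpha> T] by (simp add: refines_def[of T])
qed

lemma restr_disjoint:
  assumes "refines S \<beta> \<alpha>" "T \<in> \<alpha>" "T' \<in> \<alpha>" "B \<in> restr \<beta> T" "B \<in> restr \<beta> T'"
  shows "T = T'"
proof -
  have "B \<subseteq> T" "B \<subseteq> T'" "B \<noteq> {}"
    using assms by (auto simp: restr_def refines_def partition_on_def)
  then show ?thesis
    using assms partition_on_unique[of S \<alpha> T T'] by (auto simp: refines_def)
qed

lemma Union_restr_family: "refines S \<beta> \<alpha> \<Longrightarrow> (\<Union>T\<in>\<alpha>. restr \<beta> T) = \<beta>"
  by (auto simp: restr_def refines_def)

lemma inj_on_image_subset_iff: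
  assumes "inj_on f C" "A \<subseteq> C" "B \<subseteq> C"
  shows "f ` A \<subseteq> f ` B \<longleftrightarrow> A \<subseteq> B"
proof
  assume "f ` A \<subseteq> f ` B"
  then show "A \<subseteq> B" using assms by (metis image_subset_iff inj_on_image_mem_iff subset_iff)
qed auto

lemma Ob_mono_iff:
  assumes "\<And>T. T \<in> A \<union> B \<Longrightarrow> finite T"
  shows "Ob A \<subseteq> Ob B \<longleftrightarrow> A \<subseteq> B"
  unfolding Ob_def using inj_on_enc[of "A \<union> B", OF assms] by (intro inj_on_image_subset_iff) auto

lemma Ob_inject:
  assumes "\<And>T. T \<in> A \<union> B \<Longrightarrow> finite T"
  shows "Ob A = Ob B \<longleftrightarrow> A = B"
  using Ob_mono_iff[of A B] Ob_mono_iff[of B A] assms by blast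

section \<open>Quotients of partitions\<close>

text \<open>B and T are both unions of the blocks of \<gamma> they contain, so containment can be
  read off from those blocks.\<close>

lemma restr_subset_iff:
  assumes "refines S \<gamma> \<beta>" "refines S \<beta> \<alpha>" "B \<in> \<beta>" "T \<in> \<alpha>"
  shows "restr \<gamma> B \<subseteq> restr \<gamma> T \<longleftrightarrow> B \<subseteq> T"
proof
  have "refines S \<gamma> \<alpha>" using assms refines_trans by blast
  moreover assume "restr \<gamma> B \<subseteq> restr \<gamma> T"
  ultimately show "B \<subseteq> T" using Union_restr assms by (metis Union_mono)
qed (auto simp: restr_def)

lemma inj_on_Ob_restr:
  assumes "fin S" "refines S \<gamma> \<beta>"
  shows "inj_on (\<lambda>T. Ob (restr \<gamma> T)) \<beta>"
proof (rule inj_onI)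
  fix T T' assume T: "T \<in> \<beta>" "T' \<in> \<beta>" and eq: "Ob (restr \<gamma> T) = Ob (restr \<gamma> T')"
  have "finite C" if "C \<in> restr \<gamma> T \<union> restr \<gamma> T'" for C
    using that assms finite_block[of S \<gamma> C] by (auto simp: restr_def refines_def)
  then have "restr \<gamma> T = restr \<gamma> T'" using Ob_inject eq by metis
  then show "T = T'" using Union_restr assms T by metis
qed

lemma bij_betw_quot:
  "fin S \<Longrightarrow> refines S \<gamma> \<beta> \<Longrightarrow> bij_betw (\<lambda>T. Ob (restr \<gamma> T)) \<beta> (quot \<beta> \<gamma>)"
  by (simp add: bij_betw_def inj_on_Ob_restr quot_def)

text \<open>Disjointness is tested on codes: a common code decodes to one block of \<gamma>, and
  that block lies in a single block of \<beta>.\<close>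

lemma partition_on_quot:
  assumes "fin S" "refines S \<gamma> \<beta>"
  shows "partition_on (Ob \<gamma>) (quot \<beta> \<gamma>)"
proof (rule partition_onI)
  have "\<Union> (quot \<beta> \<gamma>) = Ob (\<Union>T\<in>\<beta>. restr \<gamma> T)"
    by (auto simp: quot_def Ob_def)
  then show "\<Union> (quot \<beta> \<gamma>) = Ob \<gamma>"
    using Union_restr_family[OF assms(2)] by simp
  show "{} \<notin> quot \<beta> \<gamma>"
    using fin_Ob[OF fin_restr[OF assms]] by (auto simp: quot_def fin_def)
  show "disjnt U U'" if "U \<in> quot \<beta> \<gamma>" "U' \<in> quot \<beta> \<gamma>" "U \<noteq> U'" for U U'
  proof (rule ccontr)
    assume "\<not> disjnt U U'"
    then obtain T T' C C' where T: "T \<in> \<beta>" "T' \<in> \<beta>" "C \<in> restr \<gamma> T" "C' \<in> restr \<gamma> T'"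
      and eq: "enc C = enc C'" "U = Ob (restr \<gamma> T)" "U' = Ob (restr \<gamma> T')"
      using \<open>U \<in> quot \<beta> \<gamma>\<close> \<open>U' \<in> quot \<beta> \<gamma>\<close> by (auto simp: quot_def Ob_def disjnt_def)
    then have "finite C" "finite C'"
      using assms finite_block[of S \<gamma>] by (auto simp: restr_def refines_def)
    then have "C = C'" using eq dec_enc by metis
    then show False using restr_disjoint[OF assms(2)] T eq \<open>U \<noteq> U'\<close> by metis
  qed
qed

text \<open>This is the compatibility with nested blocks that makes passing to the quotient by
  \<gamma> a \<open>refinement_iso\<close>. Containment of codes reduces to containment of
  blocks.\<close>

lemma restr_quot:
  assumes "fin S" "refines S \<gamma> \<beta>" "refines S \<beta> \<alpha>" "T \<in> \<alpha>"
  shows "restr (quot \<beta> \<gamma>) (Ob (restr \<gamma> T)) = (\<lambda>B. Ob (restr \<gamma> B)) ` restr \<beta> T"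
proof -
  have "Ob (restr \<gamma> B) \<subseteq> Ob (restr \<gamma> T) \<longleftrightarrow> B \<subseteq> T" if "B \<in> \<beta>" for B
  proof -
    have "finite C" if "C \<in> restr \<gamma> B \<union> restr \<gamma> T" for C
      using that assms finite_block[of S \<gamma> C] by (auto simp: restr_def refines_def)
    then have "Ob (restr \<gamma> B) \<subseteq> Ob (restr \<gamma> T) \<longleftrightarrow> restr \<gamma> B \<subseteq> restr \<gamma> T"
      by (rule Ob_mono_iff)
    also have "\<dots> \<longleftrightarrow> B \<subseteq> T" using restr_subset_iff assms that by blast
    finally show ?thesis .
  qed
  then show ?thesis unfolding restr_def[of "quot \<beta> \<gamma>"] restr_def[of \<beta>] by (auto simp: quot_def)
qed

lemma refines_quot:
  assumes "fin S" "refines S \<gamma> \<beta>" "refines S \<beta> \<alpha>"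
  shows "refines (Ob \<gamma>) (quot \<beta> \<gamma>) (quot \<alpha> \<gamma>)"
proof -
  have "refines S \<gamma> \<alpha>" using assms refines_trans by blast
  moreover have "\<exists>V\<in>quot \<alpha> \<gamma>. U \<subseteq> V" if "U \<in> quot \<beta> \<gamma>" for U
  proof -
    from that obtain B where B: "B \<in> \<beta>" "U = Ob (restr \<gamma> B)" by (auto simp: quot_def)
    then obtain T where "T \<in> \<alpha>" "B \<subseteq> T" using assms(3) by (auto simp: refines_def)
    moreover have "Ob (restr \<gamma> B) \<subseteq> Ob (restr \<gamma> T)"
      using \<open>B \<subseteq> T\<close> by (auto simp: Ob_def restr_def)
    ultimately show ?thesis using B by (auto simp: quot_def)
  qed
  ultimately show ?thesis
    using assms by (simp add: refines_def[of "Ob \<gamma>"] partition_on_quot[OF assms(1)])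
qed

section \<open>Images of partitions under bijections\<close>

text \<open>Counterpart of \<open>restr_quot\<close> for a bijection: injectivity on all of S allows
  containment of images to be reflected.\<close>

lemma restr_image:
  assumes "inj_on f S" "\<Union> \<beta> \<subseteq> S" "T \<subseteq> S"
  shows "restr ((`) f ` \<beta>) (f ` T) = (`) f ` restr \<beta> T"
proof -
  have "f ` B \<subseteq> f ` T \<longleftrightarrow> B \<subseteq> T" if "B \<in> \<beta>" for B
  proof -
    have "B \<subseteq> S" using assms(2) that by blast
    then show ?thesis using inj_on_image_subset_iff[OF assms(1) _ assms(3)] by blast
  qed
  then show ?thesis by (auto simp: restr_def)
qed

lemma partition_on_image:
  assumes "bij_betw f S S'" "partition_on S \<pi>"
  shows "partition_on S' ((`) f ` \<pi>)"
proof -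
  have "{} \<notin> (`) f ` \<pi>" using partition_onD3[OF assms(2)] by auto
  then show ?thesis
    using partition_on_inj_image[OF assms(2), of f] assms(1) by (simp add: bij_betw_def)
qed

lemma inj_on_image_partition:
  "inj_on f S \<Longrightarrow> partition_on S \<pi> \<Longrightarrow> inj_on ((`) f) \<pi>"
  by (rule inj_on_image) (simp add: partition_on_def)

lemma refines_image:
  assumes "bij_betw f S S'" "refines S \<beta> \<alpha>"
  shows "refines S' ((`) f ` \<beta>) ((`) f ` \<alpha>)"
  using assms(2) partition_on_image[OF assms(1)] by (simp add: refines_def) (meson image_mono)

section \<open>The coarsest and the finest partition\<close>

lemma refines_whole: "fin S \<Longrightarrow> partition_on S \<pi> \<Longrightarrow> refines S \<pi> {S}"
  by (auto simp: refines_def fin_def partition_on_def)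

lemma refines_singletons: "partition_on S \<pi> \<Longrightarrow> refines S ((\<lambda>s. {s}) ` S) \<pi>"
  using partition_on_singletons by (auto simp: refines_def partition_on_def)

text \<open>Coarser is smaller, so {S} lies below everything: a minimal element must equal it, and
  antisymmetry of refinement makes it minimal.\<close>

lemma minimal_elts_Part:
  assumes "fin S"
  shows "minimal_elts (carr Part S) (le Part S) = {{S}}"
proof -
  have "partition_on S {S}" using refines_whole[of S "{S}"] assms
    by (auto simp: fin_def partition_on_def)
  moreover have "\<pi> = {S}" if "refines S {S} \<pi>" for \<pi>
    using that assms refines_whole[of S \<pi>] by (metis refines_asym refines_def)
  ultimately show ?thesis
    using refines_whole[OF assms] by (fastforce simp: minimal_elts_def Part_def)
qed

lemma maximal_elts_Part: "maximal_elts (carr Part S) (le Part S) = {(\<lambda>s. {s}) ` S}"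
proof -
  have "\<pi> = (\<lambda>s. {s}) ` S" if "refines S \<pi> ((\<lambda>s. {s}) ` S)" for \<pi>
    using that refines_singletons[of S \<pi>] by (metis refines_asym refines_def)
  then show ?thesis
    using refines_singletons[of S] partition_on_singletons[of S]
    by (fastforce simp: maximal_elts_def Part_def)
qed

section \<open>Composition along indexed families\<close>

context species
begin

lemma act_in_image:
  "fin S \<Longrightarrow> inj_on f S \<Longrightarrow> x \<in> carr P S \<Longrightarrow> act P S f x \<in> carr P (f ` S)"
  using act_in inj_on_imp_bij_betw by blast

lemma act_act:
  assumes "fin S" "inj_on f S" "inj_on g (f ` S)" "x \<in> carr P S"
  shows "act P (f ` S) g (act P S f x) = act P S (g \<circ> f) x"
  using act_comp[OF assms(1) inj_on_imp_bij_betw[OF assms(2)] inj_on_imp_bij_betw[OF assms(3)] assms(4)]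
  by simp

lemma act_eq_id: "fin S \<Longrightarrow> (\<And>s. s \<in> S \<Longrightarrow> f s = s) \<Longrightarrow> x \<in> carr P S \<Longrightarrow> act P S f x = x"
  using act_cong[of S f "\<lambda>s. s" x] act_id by (simp add: inj_on_def)

end

section \<open>Disjoint families of blocks\<close>

text \<open>Since \<open>fin\<close> includes non-emptiness, disjointness makes F injective on J:
  the blocks form a partition of their union, and each block determines its label.\<close>

definition block_family :: "'a hf set \<Rightarrow> ('a hf \<Rightarrow> 'a hf set) \<Rightarrow> bool" where
  "block_family J F \<longleftrightarrow> fin J \<and> disjoint_family_on F J \<and> (\<forall>j\<in>J. fin (F j))"

text \<open>
  The composite of \<open>\<xi> \<in> P(J)\<close> with \<open>\<mu> j \<in> P(F j)\<close>, an element of \<open>P(\<Union>j\<in>J. F j)\<close>. Indexing the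
  blocks by \<open>J\<close> hides the codes of the blocks, and turns all the composites that occur below
  into instances of one operation.
\<close>

definition family_comp :: "('a hf, 'o, 'm) operad_data_scheme \<Rightarrow> 'a hf set \<Rightarrow>
    ('a hf \<Rightarrow> 'a hf set) \<Rightarrow> 'o \<Rightarrow> ('a hf \<Rightarrow> 'o) \<Rightarrow> 'o" where
  "family_comp P J F \<xi> \<mu> =
     comp P (F ` J) (act P J (\<lambda>j. enc (F j)) \<xi>) (\<lambda>U\<in>F ` J. \<mu> (the_inv_into J F U))"

lemma block_family_disjoint:
  "block_family J F \<Longrightarrow> i \<in> J \<Longrightarrow> j \<in> J \<Longrightarrow> i \<noteq> j \<Longrightarrow> F i \<inter> F j = {}"
  by (auto simp: block_family_def disjoint_family_on_def)

lemma block_family_inj_on: "block_family J F \<Longrightarrow> inj_on F J"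
  by (rule inj_onI) (metis block_family_def block_family_disjoint fin_def inf.idem)

lemma block_family_partition_on:
  assumes "block_family J F"
  shows "partition_on (\<Union>j\<in>J. F j) (F ` J)"
proof (rule partition_onI)
  show "disjnt U V" if "U \<in> F ` J" "V \<in> F ` J" "U \<noteq> V" for U V
    using that block_family_disjoint[OF assms] unfolding disjnt_def by blast
qed (use assms in \<open>auto simp: block_family_def fin_def\<close>)

lemma block_family_fin: "block_family J F \<Longrightarrow> fin (\<Union>j\<in>J. F j)"
  by (auto simp: block_family_def fin_def)

lemma block_family_inj_on_enc: "block_family J F \<Longrightarrow> inj_on (\<lambda>j. enc (F j)) J"
  by (rule inj_onI) (metis block_family_def block_family_inj_on dec_enc fin_def inj_onD)

lemma block_family_subset: "block_family J F \<Longrightarrow> K \<subseteq> J \<Longrightarrow> K \<noteq> {} \<Longrightarrow> block_family K F"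
  by (auto simp: block_family_def fin_def disjoint_family_on_def intro: finite_subset)

text \<open>These are the outer blocks in the associativity law: the blocks of G grouped along F.
  Distinct groups are disjoint because their labels come from disjoint sets.\<close>

lemma block_family_Union:
  assumes "block_family J F" "block_family (\<Union>j\<in>J. F j) G"
  shows "block_family J (\<lambda>j. \<Union>k\<in>F j. G k)"
  unfolding block_family_def
proof (intro conjI ballI)
  show "fin J" using assms(1) by (simp add: block_family_def)
  show "disjoint_family_on (\<lambda>j. \<Union>k\<in>F j. G k) J"
    unfolding disjoint_family_on_def
  proof (intro ballI impI)
    fix i j assume ij: "i \<in> J" "j \<in> J" "i \<noteq> j"
    have "G k \<inter> G l = {}" if "k \<in> F i" "l \<in> F j" for k l
    proof -
      have "k \<noteq> l" using that ij assms(1) by (auto simp: block_family_def disjoint_family_on_def)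
      then show ?thesis using that ij assms(2) by (auto simp: block_family_def disjoint_family_on_def)
    qed
    then show "(\<Union>k\<in>F i. G k) \<inter> (\<Union>k\<in>F j. G k) = {}" by blast
  qed
  show "fin (\<Union>k\<in>F j. G k)" if "j \<in> J" for j
    using that assms by (auto simp: block_family_def fin_def)
qed

lemma block_family_image:
  assumes "block_family J F" "inj_on f (\<Union>j\<in>J. F j)"
  shows "block_family J (\<lambda>j. f ` F j)"
  unfolding block_family_def
proof (intro conjI ballI)
  show "fin J" using assms(1) by (simp add: block_family_def)
  show "disjoint_family_on (\<lambda>j. f ` F j) J"
    unfolding disjoint_family_on_def
  proof (intro ballI impI)
    fix i j assume ij: "i \<in> J" "j \<in> J" "i \<noteq> j"
    then have "F i \<inter> F j = {}" using assms(1) by (auto simp: block_family_def disjoint_family_on_def)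
    then show "f ` F i \<inter> f ` F j = {}"
      using ij inj_on_image_Int[OF assms(2), of "F i" "F j"] by (auto simp: UN_upper)
  qed
  show "fin (f ` F j)" if "j \<in> J" for j
    using that assms(1) by (auto simp: block_family_def fin_def)
qed

text \<open>The instance through which \<open>comp_over\<close> becomes a
  \<open>family_comp\<close>: the label of a block of \<alpha> is its code, and \<open>dec\<close>
  recovers the block.\<close>

lemma block_family_restr:
  assumes "fin S" "refines S \<beta> \<alpha>"
  shows "block_family (Ob \<alpha>) (\<lambda>u. Ob (restr \<beta> (dec u)))"
  unfolding block_family_def
proof (intro conjI ballI)
  have p: "partition_on S \<alpha>" "partition_on S \<beta>" using assms by (auto simp: refines_def)
  then have fin\<alpha>: "finite T" if "T \<in> \<alpha>" for T using finite_block[OF assms(1)] that by blast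
  show "fin (Ob \<alpha>)" using fin_Ob_partition[OF assms(1) p(1)] .
  show "fin (Ob (restr \<beta> (dec u)))" if "u \<in> Ob \<alpha>" for u
    using that fin_Ob[OF fin_restr[OF assms]] by (auto simp: Ob_def dec_enc fin\<alpha>)
  show "disjoint_family_on (\<lambda>u. Ob (restr \<beta> (dec u))) (Ob \<alpha>)"
    unfolding disjoint_family_on_def
  proof (intro ballI impI)
    fix u v assume "u \<in> Ob \<alpha>" "v \<in> Ob \<alpha>" "u \<noteq> v"
    then obtain T T' where T: "T \<in> \<alpha>" "T' \<in> \<alpha>" "T \<noteq> T'" "u = enc T" "v = enc T'"
      by (auto simp: Ob_def)
    moreover have "disjnt (Ob (restr \<beta> T)) (Ob (restr \<beta> T'))"
    proof -
      have "Ob (restr \<beta> T) \<noteq> Ob (restr \<beta> T')"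
        using T inj_on_Ob_restr[OF assms] by (auto dest: inj_onD)
      then show ?thesis
        using T partition_onD2[OF partition_on_quot[OF assms]]
        by (auto simp: quot_def disjoint_def disjnt_def)
    qed
    ultimately show "Ob (restr \<beta> (dec u)) \<inter> Ob (restr \<beta> (dec v)) = {}"
      by (simp add: dec_enc fin\<alpha> disjnt_def)
  qed
qed

lemma Union_Ob_restr:
  assumes "fin S" "refines S \<beta> \<alpha>"
  shows "(\<Union>u\<in>Ob \<alpha>. Ob (restr \<beta> (dec u))) = Ob \<beta>"
proof -
  have "finite T" if "T \<in> \<alpha>" for T using finite_block[OF assms(1)] assms(2) that by (auto simp: refines_def)
  then have "(\<Union>u\<in>Ob \<alpha>. Ob (restr \<beta> (dec u))) = Ob (\<Union>T\<in>\<alpha>. restr \<beta> T)"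
    by (auto simp: Ob_def dec_enc)
  then show ?thesis using Union_restr_family[OF assms(2)] by simp
qed

section \<open>The operad laws for composites along families\<close>

context set_operad
begin

text \<open>\<open>on_Ob k \<circ> on_Ob h\<close> and \<open>on_Ob (k \<circ> h)\<close> agree
  where the intermediate set is finite, in particular on \<open>Ob \<alpha>\<close>;
  \<open>act_cong\<close> then identifies their actions.\<close>

lemma act_on_Ob_act_on_Ob:
  assumes "fin \<alpha>" "\<And>T. T \<in> \<alpha> \<Longrightarrow> finite T" "\<And>T. T \<in> h ` \<alpha> \<Longrightarrow> finite T"
    and "inj_on h \<alpha>" "\<And>T. T \<in> k ` h ` \<alpha> \<Longrightarrow> finite T" "inj_on k (h ` \<alpha>)" "\<xi> \<in> carr P (Ob \<alpha>)"
  shows "act P (Ob (h ` \<alpha>)) (on_Ob k) (act P (Ob \<alpha>) (on_Ob h) \<xi>) = act P (Ob \<alpha>) (on_Ob (k \<circ> h)) \<xi>"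
proof -
  have h: "bij_betw (on_Ob h) (Ob \<alpha>) (Ob (h ` \<alpha>))"
    using assms by (intro bij_betw_on_Ob inj_on_imp_bij_betw) auto
  have k: "bij_betw (on_Ob k) (Ob (h ` \<alpha>)) (Ob (k ` h ` \<alpha>))"
    using assms by (intro bij_betw_on_Ob inj_on_imp_bij_betw) auto
  have "act P (Ob (h ` \<alpha>)) (on_Ob k) (act P (Ob \<alpha>) (on_Ob h) \<xi>) =
    act P (Ob \<alpha>) (on_Ob k \<circ> on_Ob h) \<xi>"
    using act_comp[OF fin_Ob[OF assms(1)] h k assms(7)] by simp
  also have "\<dots> = act P (Ob \<alpha>) (on_Ob (k \<circ> h)) \<xi>"
  proof (rule act_cong[OF fin_Ob[OF assms(1)] _ _ assms(7)])
    show "inj_on (on_Ob k \<circ> on_Ob h) (Ob \<alpha>)"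
      using bij_betw_trans[OF h k] by (simp add: bij_betw_def)
    show "(on_Ob k \<circ> on_Ob h) s = on_Ob (k \<circ> h) s" if "s \<in> Ob \<alpha>" for s
      using that assms(2,3) by (auto simp: Ob_def on_Ob_enc)
  qed
  finally show ?thesis .
qed

lemma act_on_Ob_cong:
  assumes "fin \<alpha>" "\<And>T. T \<in> \<alpha> \<Longrightarrow> finite T" "\<And>T. T \<in> h ` \<alpha> \<Longrightarrow> finite T"
    and "inj_on h \<alpha>" "\<And>T. T \<in> \<alpha> \<Longrightarrow> h T = k T" "\<xi> \<in> carr P (Ob \<alpha>)"
  shows "act P (Ob \<alpha>) (on_Ob h) \<xi> = act P (Ob \<alpha>) (on_Ob k) \<xi>"
proof (rule act_cong[OF fin_Ob[OF assms(1)] _ _ assms(6)])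
  have "bij_betw (on_Ob h) (Ob \<alpha>) (Ob (h ` \<alpha>))"
    using assms by (intro bij_betw_on_Ob inj_on_imp_bij_betw) auto
  then show "inj_on (on_Ob h) (Ob \<alpha>)" by (simp add: bij_betw_def)
  show "on_Ob h s = on_Ob k s" if "s \<in> Ob \<alpha>" for s
    using that assms(2,5) by (auto simp: Ob_def on_Ob_enc)
qed

lemma family_comp_args:
  assumes "block_family J F" "\<xi> \<in> carr P J" "\<And>j. j \<in> J \<Longrightarrow> \<mu> j \<in> carr P (F j)"
  shows "act P J (\<lambda>j. enc (F j)) \<xi> \<in> carr P (Ob (F ` J))"
    and "(\<lambda>U\<in>F ` J. \<mu> (the_inv_into J F U)) \<in> (\<Pi>\<^sub>E U\<in>F ` J. carr P U)"
proof -
  have "fin J" using assms(1) by (simp add: block_family_def)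
  then show "act P J (\<lambda>j. enc (F j)) \<xi> \<in> carr P (Ob (F ` J))"
    using act_in_image[OF _ block_family_inj_on_enc[OF assms(1)] assms(2)]
    by (simp add: Ob_def image_image)
  show "(\<lambda>U\<in>F ` J. \<mu> (the_inv_into J F U)) \<in> (\<Pi>\<^sub>E U\<in>F ` J. carr P U)"
    using assms(3) by (auto simp: the_inv_into_f_f[OF block_family_inj_on[OF assms(1)]])
qed

lemma family_comp_in:
  assumes "block_family J F" "\<xi> \<in> carr P J" "\<And>j. j \<in> J \<Longrightarrow> \<mu> j \<in> carr P (F j)"
  shows "family_comp P J F \<xi> \<mu> \<in> carr P (\<Union>j\<in>J. F j)"
  unfolding family_comp_def
  using family_comp_args[OF assms] assms(1)
  by (intro comp_in[OF block_family_fin block_family_partition_on])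

text \<open>The set of blocks is unchanged, and transporting \<xi> first along g and then to the
  codes of the blocks of F' is transporting it directly to the codes of the blocks of F. Both sides
  are thus the same \<open>comp\<close>.\<close>

lemma family_comp_reindex:
  assumes "block_family J F" "inj_on g J" "\<xi> \<in> carr P J" "\<And>j. j \<in> J \<Longrightarrow> F' (g j) = F j"
    and "\<And>j. j \<in> J \<Longrightarrow> \<mu>' (g j) = \<mu> j"
  shows "family_comp P (g ` J) F' (act P J g \<xi>) \<mu>' = family_comp P J F \<xi> \<mu>"
proof -
  have J: "fin J" using assms(1) by (simp add: block_family_def)
  have inj: "inj_on F J" using block_family_inj_on[OF assms(1)] .
  have img: "F' ` g ` J = F ` J" using assms(4) by (auto simp: image_image)
  have inj': "inj_on F' (g ` J)"
    using inj assms(4) by (auto simp: inj_on_def)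
  have "inj_on (\<lambda>j. enc (F' j)) (g ` J)"
    using block_family_inj_on_enc[OF assms(1)] assms(4) by (auto simp: inj_on_def)
  then have "act P (g ` J) (\<lambda>j. enc (F' j)) (act P J g \<xi>) = act P J ((\<lambda>j. enc (F' j)) \<circ> g) \<xi>"
    by (rule act_act[OF J assms(2) _ assms(3)])
  also have "\<dots> = act P J (\<lambda>j. enc (F j)) \<xi>"
    using block_family_inj_on_enc[OF assms(1)] assms(4)
    by (intro act_cong[OF J _ _ assms(3)]) (auto simp: inj_on_def)
  moreover have "(\<lambda>U\<in>F' ` g ` J. \<mu>' (the_inv_into (g ` J) F' U)) = (\<lambda>U\<in>F ` J. \<mu> (the_inv_into J F U))"
    unfolding img
  proof (rule restrict_ext)
    fix U assume "U \<in> F ` J"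
    then obtain j where j: "j \<in> J" "U = F j" by blast
    have "the_inv_into (g ` J) F' U = g j"
      using the_inv_into_f_f[OF inj', of "g j"] j assms(4) by simp
    then show "\<mu>' (the_inv_into (g ` J) F' U) = \<mu> (the_inv_into J F U)"
      using j the_inv_into_f_f[OF inj] assms(5) by simp
  qed
  ultimately show ?thesis by (simp add: family_comp_def img)
qed

lemma family_comp_cong:
  assumes "block_family J F" "\<xi> \<in> carr P J" "\<And>j. j \<in> J \<Longrightarrow> F' j = F j" "\<And>j. j \<in> J \<Longrightarrow> \<mu>' j = \<mu> j"
  shows "family_comp P J F' \<xi> \<mu>' = family_comp P J F \<xi> \<mu>"
  using family_comp_reindex[of J F "\<lambda>j. j" \<xi> F' \<mu>' \<mu>] assms act_id[of J]
  by (simp add: block_family_def)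

text \<open>Because blocks are labelled, only they move and \<xi> stays put: the map induced by f on
  codes sends the code of \<open>F j\<close> to the code of its image, so it merges with the
  transport of \<xi> inside \<open>family_comp\<close>.\<close>

lemma family_comp_natural:
  assumes "block_family J F" "inj_on f (\<Union>j\<in>J. F j)" "\<xi> \<in> carr P J"
    and "\<And>j. j \<in> J \<Longrightarrow> \<mu> j \<in> carr P (F j)"
  shows "act P (\<Union>j\<in>J. F j) f (family_comp P J F \<xi> \<mu>) =
    family_comp P J (\<lambda>j. f ` F j) \<xi> (\<lambda>j. act P (F j) f (\<mu> j))"
proof -
  define X where "X = (\<Union>j\<in>J. F j)"
  have J: "fin J" using assms(1) by (simp add: block_family_def)
  have fam': "block_family J (\<lambda>j. f ` F j)" using block_family_image[OF assms(1,2)] .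
  have fF: "finite (F j)" if "j \<in> J" for j using assms(1) that by (simp add: block_family_def fin_def)
  have img: "(`) f ` F ` J = (\<lambda>j. f ` F j) ` J" by auto
  have "bij_betw f X (f ` X)" using assms(2) inj_on_imp_bij_betw X_def by blast
  note nat = comp_natural[OF block_family_fin[OF assms(1), folded X_def] this
    block_family_partition_on[OF assms(1), folded X_def] family_comp_args[OF assms(1,3,4)]]
  have "act P (Ob (F ` J)) (on_Ob ((`) f)) (act P J (\<lambda>j. enc (F j)) \<xi>) = act P J (\<lambda>j. enc (f ` F j)) \<xi>"
  proof -
    have Ob: "Ob (F ` J) = (\<lambda>j. enc (F j)) ` J" by (auto simp: Ob_def)
    have eq: "on_Ob ((`) f) (enc (F j)) = enc (f ` F j)" if "j \<in> J" for j
      using on_Ob_enc fF that by blast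
    have "inj_on (on_Ob ((`) f)) ((\<lambda>j. enc (F j)) ` J)"
      using block_family_inj_on_enc[OF fam'] eq by (auto simp: inj_on_def)
    then have "act P (Ob (F ` J)) (on_Ob ((`) f)) (act P J (\<lambda>j. enc (F j)) \<xi>) =
        act P J (on_Ob ((`) f) \<circ> (\<lambda>j. enc (F j))) \<xi>"
      unfolding Ob using act_act[OF J block_family_inj_on_enc[OF assms(1)] _ assms(3)] by blast
    also have "\<dots> = act P J (\<lambda>j. enc (f ` F j)) \<xi>"
      using block_family_inj_on_enc[OF fam'] eq
      by (intro act_cong[OF J _ _ assms(3)]) (auto simp: inj_on_def)
    finally show ?thesis .
  qed
  moreover have "(\<lambda>T'\<in>(`) f ` F ` J. act P (f -` T' \<inter> X) f
      ((\<lambda>U\<in>F ` J. \<mu> (the_inv_into J F U)) (f -` T' \<inter> X))) =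
    (\<lambda>U\<in>(\<lambda>j. f ` F j) ` J. act P (F (the_inv_into J (\<lambda>j. f ` F j) U)) f (\<mu> (the_inv_into J (\<lambda>j. f ` F j) U)))"
    unfolding img
  proof (rule restrict_ext)
    fix U assume "U \<in> (\<lambda>j. f ` F j) ` J"
    then obtain j where j: "j \<in> J" "U = f ` F j" by blast
    then have "F j \<subseteq> X" by (auto simp: X_def)
    \<comment> \<open>\<open>comp_natural\<close> recovers the old block as a preimage inside X;
      injectivity of f on X makes this preimage exactly \<open>F j\<close>.\<close>
    then have "f -` U \<inter> X = F j"
      using assms(2) j unfolding X_def[symmetric] by (auto dest: inj_onD)
    then show "act P (f -` U \<inter> X) f ((\<lambda>U\<in>F ` J. \<mu> (the_inv_into J F U)) (f -` U \<inter> X)) =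
      act P (F (the_inv_into J (\<lambda>j. f ` F j) U)) f (\<mu> (the_inv_into J (\<lambda>j. f ` F j) U))"
      using j the_inv_into_f_f[OF block_family_inj_on[OF assms(1)]]
        the_inv_into_f_f[OF block_family_inj_on[OF fam']] by simp
  qed
  ultimately show ?thesis
    using nat by (simp add: family_comp_def X_def[symmetric] img)
qed

text \<open>The two sides differ only in how T is found from its class U: as the union of the
  decoded elements of U, or through the inverse of the labelling.\<close>

lemma comp_over_eq_family_comp:
  assumes "fin S" "refines S \<beta> \<alpha>"
  shows "comp_over P \<alpha> \<beta> \<xi> \<mu> =
    family_comp P (Ob \<alpha>) (\<lambda>u. Ob (restr \<beta> (dec u))) \<xi> (\<lambda>u. \<mu> (dec u))"
proof -
  have p: "partition_on S \<alpha>" "partition_on S \<beta>" using assms(2) by (auto simp: refines_def)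
  have fin\<alpha>: "finite T" if "T \<in> \<alpha>" for T using finite_block[OF assms(1) p(1)] that by blast
  have img: "(\<lambda>u. Ob (restr \<beta> (dec u))) ` Ob \<alpha> = quot \<alpha> \<beta>"
    by (auto simp: Ob_def quot_def dec_enc fin\<alpha> image_image)
  have "(\<lambda>U\<in>quot \<alpha> \<beta>. \<mu> (\<Union> (dec ` U))) =
    (\<lambda>U\<in>quot \<alpha> \<beta>. \<mu> (dec (the_inv_into (Ob \<alpha>) (\<lambda>u. Ob (restr \<beta> (dec u))) U)))"
  proof (rule restrict_ext)
    fix U assume "U \<in> quot \<alpha> \<beta>"
    then obtain T where T: "T \<in> \<alpha>" "U = Ob (restr \<beta> T)" by (auto simp: quot_def)
    have "finite B" if "B \<in> restr \<beta> T" for B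
      using finite_block[OF assms(1) p(2)] that by (auto simp: restr_def)
    then have "\<Union> (dec ` U) = T"
      using T Union_restr[OF assms(2)] by (simp add: Ob_def dec_image_enc)
    moreover have "the_inv_into (Ob \<alpha>) (\<lambda>u. Ob (restr \<beta> (dec u))) U = enc T"
      using the_inv_into_f_f[OF block_family_inj_on[OF block_family_restr[OF assms]], of "enc T"] T
      by (simp add: Ob_def[of \<alpha>] dec_enc fin\<alpha>)
    ultimately show "\<mu> (\<Union> (dec ` U)) = \<mu> (dec (the_inv_into (Ob \<alpha>) (\<lambda>u. Ob (restr \<beta> (dec u))) U))"
      using T fin\<alpha> by (simp add: dec_enc)
  qed
  then show ?thesis by (simp add: comp_over_def family_comp_def img on_Ob_def)
qed

text \<open>\<open>comp_assoc\<close> for two nested partitions of the union X of all blocks of G: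
  the finer one consists of these blocks, the coarser one groups them by the sets
  \<open>F j\<close>. The work lies in matching labels with codes.\<close>

lemma family_comp_assoc:
  assumes F: "block_family J F" and K: "K = (\<Union>j\<in>J. F j)" and G: "block_family K G"
    and \<xi>: "\<xi> \<in> carr P J" and \<mu>: "\<And>j. j \<in> J \<Longrightarrow> \<mu> j \<in> carr P (F j)"
    and \<nu>: "\<And>k. k \<in> K \<Longrightarrow> \<nu> k \<in> carr P (G k)"
  shows "family_comp P K G (family_comp P J F \<xi> \<mu>) \<nu> =
    family_comp P J (\<lambda>j. \<Union>k\<in>F j. G k) \<xi> (\<lambda>j. family_comp P (F j) G (\<mu> j) \<nu>)"
proof -
  \<comment> \<open>The arguments for \<open>comp_assoc\<close>: decorations indexed by labels are
    moved to codes of blocks, and families on labels become extensional families on blocks.\<close>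
  define H where "H = (\<lambda>j. \<Union>k\<in>F j. G k)"
  define X where "X = (\<Union>k\<in>K. G k)"
  define \<alpha> where "\<alpha> = H ` J"
  define \<beta> where "\<beta> = G ` K"
  define \<xi>' where "\<xi>' = act P J (\<lambda>j. enc (H j)) \<xi>"
  define \<mu>' where "\<mu>' = (\<lambda>T\<in>\<alpha>. act P (F (the_inv_into J H T)) (\<lambda>k. enc (G k)) (\<mu> (the_inv_into J H T)))"
  define \<nu>' where "\<nu>' = (\<lambda>V\<in>\<beta>. \<nu> (the_inv_into K G V))"
  have J: "fin J" using F by (simp add: block_family_def)
  have H: "block_family J H" unfolding H_def using block_family_Union F G K by blast
  have UH: "(\<Union>j\<in>J. H j) = X" by (auto simp: H_def X_def K)
  have FK: "F j \<subseteq> K" if "j \<in> J" for j using that K by blast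
  have Fne: "F j \<noteq> {}" if "j \<in> J" for j using that F by (auto simp: block_family_def fin_def)
  have GF: "block_family (F j) G" if "j \<in> J" for j using block_family_subset[OF G FK Fne] that by blast
  have injG: "inj_on G K" and injH: "inj_on H J" using block_family_inj_on G H by blast+
  have X: "fin X" using block_family_fin[OF G] X_def by simp
  have p\<alpha>: "partition_on X \<alpha>" using block_family_partition_on[OF H] by (simp add: UH \<alpha>_def)
  have p\<beta>: "partition_on X \<beta>" using block_family_partition_on[OF G] by (simp add: X_def \<beta>_def)
  have ref: "refines X \<beta> \<alpha>"
    using p\<alpha> p\<beta> by (auto simp: refines_def \<alpha>_def \<beta>_def H_def K)
  \<comment> \<open>A block \<open>G k\<close> inside \<open>H j\<close> meets some
    \<open>G l\<close> with l in \<open>F j\<close>; disjointness of the family gives k = l, so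
    restriction selects just the labels in \<open>F j\<close>.\<close>
  have restr: "restr \<beta> (H j) = G ` F j" if j: "j \<in> J" for j
  proof
    show "G ` F j \<subseteq> restr \<beta> (H j)" using FK[OF j] by (auto simp: restr_def \<beta>_def H_def)
    show "restr \<beta> (H j) \<subseteq> G ` F j"
    proof
      fix B assume "B \<in> restr \<beta> (H j)"
      then obtain k where k: "k \<in> K" "B = G k" "G k \<subseteq> (\<Union>l\<in>F j. G l)"
        by (auto simp: restr_def \<beta>_def H_def)
      moreover have "G k \<noteq> {}" using G k by (auto simp: block_family_def fin_def)
      ultimately obtain l where "l \<in> F j" "G k \<inter> G l \<noteq> {}" by blast
      then have "k = l" using block_family_disjoint[OF G] k(1) FK[OF j] by blast
      then show "B \<in> G ` F j" using k \<open>l \<in> F j\<close> by blast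
    qed
  qed
  have finH: "finite (H j)" if "j \<in> J" for j using H that by (auto simp: block_family_def fin_def)
  \<comment> \<open>\<open>family_comp_args\<close> asks for some decoration of the blocks of H; the
    inner composites provide one.\<close>
  have \<xi>': "\<xi>' \<in> carr P (Ob \<alpha>)"
    unfolding \<xi>'_def \<alpha>_def using family_comp_args(1)[OF H \<xi>, of "\<lambda>j. family_comp P (F j) G (\<mu> j) \<nu>"]
      family_comp_in[OF GF \<mu>] \<nu> FK unfolding H_def by blast
  have \<mu>'H: "\<mu>' (H j) = act P (F j) (\<lambda>k. enc (G k)) (\<mu> j)" if "j \<in> J" for j
    using that the_inv_into_f_f[OF injH] by (simp add: \<mu>'_def \<alpha>_def)
  have \<mu>'_in: "\<mu>' \<in> (\<Pi>\<^sub>E T\<in>\<alpha>. carr P (Ob (restr \<beta> T)))"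
  proof -
    have "\<mu>' (H j) \<in> carr P (Ob (restr \<beta> (H j)))" if j: "j \<in> J" for j
      using act_in_image[OF _ block_family_inj_on_enc[OF GF[OF j]] \<mu>[OF j]] F j
      by (simp add: \<mu>'H restr Ob_def image_image block_family_def)
    then show ?thesis by (auto simp: \<mu>'_def \<alpha>_def)
  qed
  have \<nu>'_in: "\<nu>' \<in> (\<Pi>\<^sub>E V\<in>\<beta>. carr P V)"
    using \<nu> by (auto simp: \<nu>'_def \<beta>_def the_inv_into_f_f[OF injG])
  have "comp P \<alpha> \<xi>' (\<lambda>T\<in>\<alpha>. comp P (restr \<beta> T) (\<mu>' T) (restrict \<nu>' (restr \<beta> T))) =
    family_comp P J H \<xi> (\<lambda>j. family_comp P (F j) G (\<mu> j) \<nu>)"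
  proof -
    have "comp P (restr \<beta> (H j)) (\<mu>' (H j)) (restrict \<nu>' (restr \<beta> (H j))) =
      family_comp P (F j) G (\<mu> j) \<nu>" if j: "j \<in> J" for j
    proof -
      have "restrict \<nu>' (G ` F j) = (\<lambda>U\<in>G ` F j. \<nu> (the_inv_into (F j) G U))"
      proof (rule restrict_ext)
        fix U assume "U \<in> G ` F j"
        then obtain k where k: "k \<in> F j" "U = G k" by blast
        then show "\<nu>' U = \<nu> (the_inv_into (F j) G U)"
          using the_inv_into_f_f[OF injG, of k]
            the_inv_into_f_f[OF block_family_inj_on[OF GF[OF j]], of k] FK[OF j]
          by (simp add: \<nu>'_def \<beta>_def subset_iff)
      qed
      then show ?thesis using j by (simp add: family_comp_def \<mu>'H restr)
    qed
    then have "(\<lambda>T\<in>\<alpha>. comp P (restr \<beta> T) (\<mu>' T) (restrict \<nu>' (restr \<beta> T))) =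
      (\<lambda>U\<in>H ` J. family_comp P (F (the_inv_into J H U)) G (\<mu> (the_inv_into J H U)) \<nu>)"
      unfolding \<alpha>_def by (intro restrict_ext) (auto simp: the_inv_into_f_f[OF injH])
    then show ?thesis by (simp add: family_comp_def[of P J] \<xi>'_def \<alpha>_def)
  qed
  \<comment> \<open>The inner composite on codes is the labelled one pushed forward along the coding
    of K: reindexing replaces codes of the blocks \<open>H j\<close> by labels, and naturality then
    pulls the coding out of the composite.\<close>
  moreover have "comp_over P \<alpha> \<beta> \<xi>' \<mu>' = act P K (\<lambda>k. enc (G k)) (family_comp P J F \<xi> \<mu>)"
  proof -
    have Ob\<alpha>: "Ob \<alpha> = (\<lambda>j. enc (H j)) ` J" by (auto simp: Ob_def \<alpha>_def)
    have injE: "inj_on (\<lambda>k. enc (G k)) (\<Union>j\<in>J. F j)" using block_family_inj_on_enc[OF G] K by simp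
    have "comp_over P \<alpha> \<beta> \<xi>' \<mu>' =
      family_comp P ((\<lambda>j. enc (H j)) ` J) (\<lambda>u. Ob (restr \<beta> (dec u))) (act P J (\<lambda>j. enc (H j)) \<xi>) (\<lambda>u. \<mu>' (dec u))"
      using comp_over_eq_family_comp[OF X ref] by (simp add: Ob\<alpha> \<xi>'_def)
    also have "\<dots> = family_comp P J (\<lambda>j. (\<lambda>k. enc (G k)) ` F j) \<xi> (\<lambda>j. act P (F j) (\<lambda>k. enc (G k)) (\<mu> j))"
      by (intro family_comp_reindex[OF block_family_image[OF F injE] block_family_inj_on_enc[OF H] \<xi>])
        (auto simp: dec_enc finH restr \<mu>'H Ob_def)
    also have "\<dots> = act P K (\<lambda>k. enc (G k)) (family_comp P J F \<xi> \<mu>)"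
      using family_comp_natural[OF F injE \<xi> \<mu>] K by simp
    finally show ?thesis .
  qed
  ultimately show ?thesis
    using comp_assoc[OF X p\<alpha> p\<beta> ref \<xi>' \<mu>'_in \<nu>'_in]
    by (simp add: family_comp_def[of P K] \<beta>_def \<nu>'_def H_def)
qed

text \<open>Naturality of units turns the unit at the label j into the unit at the code of
  \<open>F j\<close>, where \<open>unit_left\<close> applies.\<close>

lemma family_comp_unit_left:
  assumes "fin (F j)" "x \<in> carr P (F j)" "\<mu> j = x"
  shows "family_comp P {j} F (unit P j) \<mu> = x"
proof -
  have "the_inv_into {j} F (F j) = j" by (rule the_inv_into_f_f) auto
  then have "(\<lambda>U\<in>{F j}. \<mu> (the_inv_into {j} F U)) = (\<lambda>U\<in>{F j}. x)"
    using assms(3) by (intro restrict_ext) auto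
  then show ?thesis
    using unit_left[OF assms(1,2)] by (simp add: family_comp_def unit_natural)
qed

text \<open>The singleton blocks relabel J by h, so the composite lives on the image of h and the
  unit law returns \<xi> transported there.\<close>

lemma family_comp_unit_right:
  assumes "fin J" "inj_on h J" "\<xi> \<in> carr P J"
  shows "family_comp P J (\<lambda>j. {h j}) \<xi> (\<lambda>j. unit P (h j)) = act P J h \<xi>"
proof -
  have inj: "inj_on (\<lambda>j. {h j}) J" using assms(2) by (auto simp: inj_on_def)
  have img: "(\<lambda>s. {s}) ` h ` J = (\<lambda>j. {h j}) ` J" by auto
  have "inj_on (\<lambda>s. enc {s}) (h ` J)" by (rule inj_onI) (metis dec_enc finite.simps singleton_inject)
  then have "act P (h ` J) (\<lambda>s. enc {s}) (act P J h \<xi>) = act P J (\<lambda>j. enc {h j}) \<xi>"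
    using act_act[OF assms(1,2) _ assms(3), of "\<lambda>s. enc {s}"] by (simp add: o_def)
  moreover have "(\<lambda>T\<in>(\<lambda>j. {h j}) ` J. unit P (the_elem T)) =
    (\<lambda>T\<in>(\<lambda>j. {h j}) ` J. unit P (h (the_inv_into J (\<lambda>j. {h j}) T)))"
    by (intro restrict_ext) (auto simp: the_inv_into_f_f[OF inj])
  moreover have "fin (h ` J)" using assms(1) by (simp add: fin_def)
  ultimately show ?thesis
    using unit_right[of "h ` J", OF _ act_in_image[OF assms]] by (simp add: family_comp_def img)
qed

text \<open>Left-basicness gives equality of the extensional families on blocks; evaluation at the
  block \<open>F j\<close> returns to the label j.\<close>

lemma family_comp_inject:
  assumes "left_basic P" "block_family J F" "\<xi> \<in> carr P J"
    and "\<And>j. j \<in> J \<Longrightarrow> \<mu> j \<in> carr P (F j)" "\<And>j. j \<in> J \<Longrightarrow> \<mu>' j \<in> carr P (F j)"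
    and "family_comp P J F \<xi> \<mu> = family_comp P J F \<xi> \<mu>'" "j \<in> J"
  shows "\<mu> j = \<mu>' j"
proof -
  have "inj_on (comp P (F ` J) (act P J (\<lambda>j. enc (F j)) \<xi>)) (\<Pi>\<^sub>E T\<in>F ` J. carr P T)"
    using assms(1) block_family_fin[OF assms(2)] block_family_partition_on[OF assms(2)]
      family_comp_args(1)[OF assms(2,3,4)] by (auto simp: left_basic_def)
  then have "(\<lambda>U\<in>F ` J. \<mu> (the_inv_into J F U)) = (\<lambda>U\<in>F ` J. \<mu>' (the_inv_into J F U))"
    by (rule inj_onD)
      (use assms(6) family_comp_args(2)[OF assms(2,3,4)] family_comp_args(2)[OF assms(2,3,5)]
       in \<open>simp_all add: family_comp_def\<close>)
  from fun_cong[OF this, of "F j"] show ?thesis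
    using assms(7) the_inv_into_f_f[OF block_family_inj_on[OF assms(2)]] by simp
qed

end

section \<open>Left-decorated partitions\<close>

text \<open>
  Two kinds of \<open>g\<close> matter: the map induced on blocks by a bijection \<open>f\<close>, and
  \<open>T \<mapsto> Ob (restr \<gamma> T)\<close>, which passes to the quotient by \<open>\<gamma>\<close> as in \<open>\<phi>\<close>.
\<close>

definition refinement_iso :: "('a hf set \<Rightarrow> 'a hf set) \<Rightarrow> 'a hf set \<Rightarrow> 'a hf set set \<Rightarrow> 'a hf set set \<Rightarrow>
    'a hf set \<Rightarrow> 'a hf set set \<Rightarrow> 'a hf set set \<Rightarrow> bool" where
  "refinement_iso g S \<alpha> \<beta> S' \<alpha>' \<beta>' \<longleftrightarrow> fin S \<and> fin S' \<and> refines S \<beta> \<alpha> \<and> refines S' \<beta>' \<alpha>' \<and>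
     bij_betw g \<alpha> \<alpha>' \<and> bij_betw g \<beta> \<beta>' \<and> (\<forall>T\<in>\<alpha>. restr \<beta>' (g T) = g ` restr \<beta> T)"

lemma bij_betw_image_partition:
  "bij_betw f S S' \<Longrightarrow> partition_on S \<pi> \<Longrightarrow> bij_betw ((`) f) \<pi> ((`) f ` \<pi>)"
  by (meson bij_betw_imp_inj_on inj_on_image_partition inj_on_imp_bij_betw)

lemma bij_betw_fin: "bij_betw f S S' \<Longrightarrow> fin S \<Longrightarrow> fin S'"
  by (auto simp: bij_betw_def fin_def)

lemma refinement_iso_image:
  assumes "fin S" "bij_betw f S S'" "refines S \<beta> \<alpha>"
  shows "refinement_iso ((`) f) S \<alpha> \<beta> S' ((`) f ` \<alpha>) ((`) f ` \<beta>)"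
proof -
  have p: "partition_on S \<alpha>" "partition_on S \<beta>" using assms(3) by (auto simp: refines_def)
  have "restr ((`) f ` \<beta>) (f ` T) = (`) f ` restr \<beta> T" if "T \<in> \<alpha>" for T
    using restr_image[of f S \<beta> T] assms(2) p that by (auto simp: bij_betw_def partition_on_def)
  then show ?thesis
    using assms p bij_betw_image_partition[OF assms(2)] refines_image[OF assms(2,3)]
      bij_betw_fin[OF assms(2,1)]
    by (simp add: refinement_iso_def)
qed

lemma refinement_iso_quot:
  assumes "fin S" "refines S \<gamma> \<beta>" "refines S \<beta> \<alpha>"
  shows "refinement_iso (\<lambda>T. Ob (restr \<gamma> T)) S \<alpha> \<beta> (Ob \<gamma>) (quot \<alpha> \<gamma>) (quot \<beta> \<gamma>)"
proof -
  have "refines S \<gamma> \<alpha>" using refines_trans assms(2,3) by blast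
  moreover have "partition_on S \<gamma>" using assms(2) by (simp add: refines_def)
  ultimately show ?thesis
    using assms refines_quot[OF assms] bij_betw_quot[OF assms(1)] fin_Ob_partition[OF assms(1)]
      restr_quot[OF assms]
    by (simp add: refinement_iso_def)
qed

section \<open>The operad laws for composites over refinements\<close>

context set_operad
begin

lemma comp_over_in:
  assumes "fin S" "refines S \<beta> \<alpha>" "\<xi> \<in> carr P (Ob \<alpha>)"
    and "\<And>T. T \<in> \<alpha> \<Longrightarrow> \<mu> T \<in> carr P (Ob (restr \<beta> T))"
  shows "comp_over P \<alpha> \<beta> \<xi> \<mu> \<in> carr P (Ob \<beta>)"
proof -
  have "finite T" if "T \<in> \<alpha>" for T using finite_block[OF assms(1)] assms(2) that by (auto simp: refines_def)
  then have "\<mu> (dec u) \<in> carr P (Ob (restr \<beta> (dec u)))" if "u \<in> Ob \<alpha>" for u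
    using that assms(4) by (auto simp: Ob_def[of \<alpha>] dec_enc)
  then show ?thesis
    unfolding comp_over_eq_family_comp[OF assms(1,2)] Union_Ob_restr[OF assms(1,2), symmetric]
    by (rule family_comp_in[OF block_family_restr[OF assms(1,2)] assms(3)])
qed

text \<open>Only values on blocks of \<alpha> enter, since each class decodes to such a block. Hence
  arbitrary functions may stand in for the extensional families used in the order.\<close>

lemma comp_over_cong:
  assumes "fin S" "refines S \<beta> \<alpha>" "\<And>T. T \<in> \<alpha> \<Longrightarrow> \<mu> T = \<mu>' T"
  shows "comp_over P \<alpha> \<beta> \<xi> \<mu> = comp_over P \<alpha> \<beta> \<xi> \<mu>'"
proof -
  have "\<Union> (dec ` Ob (restr \<beta> T)) = T" if T: "T \<in> \<alpha>" for T
  proof -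
    have "finite B" if "B \<in> restr \<beta> T" for B
      using finite_block[OF assms(1), of \<beta> B] assms(2) that by (auto simp: restr_def refines_def)
    then show ?thesis using Union_restr[OF assms(2) T] by (simp add: Ob_def dec_image_enc)
  qed
  then have "(\<lambda>U\<in>quot \<alpha> \<beta>. \<mu> (\<Union> (dec ` U))) = (\<lambda>U\<in>quot \<alpha> \<beta>. \<mu>' (\<Union> (dec ` U)))"
    using assms(3) by (intro restrict_ext) (auto simp: quot_def)
  then show ?thesis by (simp add: comp_over_def)
qed

text \<open>Naturality moves the inner blocks along g, and reindexing along the codes of \<alpha>
  moves the outer labels; the last clause of \<open>refinement_iso\<close> says that the two fit
  together.\<close>

lemma comp_over_transport:
  assumes "refinement_iso g S \<alpha> \<beta> S' \<alpha>' \<beta>'" "\<xi> \<in> carr P (Ob \<alpha>)"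
    and "\<And>T. T \<in> \<alpha> \<Longrightarrow> \<mu> T \<in> carr P (Ob (restr \<beta> T))"
    and "\<And>T. T \<in> \<alpha> \<Longrightarrow> \<mu>' (g T) = act P (Ob (restr \<beta> T)) (on_Ob g) (\<mu> T)"
  shows "act P (Ob \<beta>) (on_Ob g) (comp_over P \<alpha> \<beta> \<xi> \<mu>) =
    comp_over P \<alpha>' \<beta>' (act P (Ob \<alpha>) (on_Ob g) \<xi>) \<mu>'"
proof -
  have S: "fin S" "refines S \<beta> \<alpha>" and S': "fin S'" "refines S' \<beta>' \<alpha>'"
    and g: "bij_betw g \<alpha> \<alpha>'" "bij_betw g \<beta> \<beta>'"
    and restr: "\<And>T. T \<in> \<alpha> \<Longrightarrow> restr \<beta>' (g T) = g ` restr \<beta> T"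
    using assms(1) by (auto simp: refinement_iso_def)
  have fin\<alpha>: "finite T" if "T \<in> \<alpha> \<or> T \<in> \<beta>" for T
    using finite_block[OF S(1)] S(2) that by (auto simp: refines_def)
  have fin\<alpha>': "finite T" if "T \<in> \<alpha>' \<or> T \<in> \<beta>'" for T
    using finite_block[OF S'(1)] S'(2) that by (auto simp: refines_def)
  have g\<alpha>: "bij_betw (on_Ob g) (Ob \<alpha>) (Ob \<alpha>')" and g\<beta>: "bij_betw (on_Ob g) (Ob \<beta>) (Ob \<beta>')"
    using bij_betw_on_Ob g fin\<alpha> fin\<alpha>' by blast+
  define F where "F = (\<lambda>u. Ob (restr \<beta> (dec u)))"
  have F: "block_family (Ob \<alpha>) F" unfolding F_def using block_family_restr[OF S] .
  have UF: "(\<Union>u\<in>Ob \<alpha>. F u) = Ob \<beta>" unfolding F_def using Union_Ob_restr[OF S] .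
  have inj: "inj_on (on_Ob g) (\<Union>u\<in>Ob \<alpha>. F u)" using g\<beta> UF by (simp add: bij_betw_def)
  have \<mu>: "\<mu> (dec u) \<in> carr P (F u)" if "u \<in> Ob \<alpha>" for u
    using that assms(3) fin\<alpha> by (auto simp: Ob_def[of \<alpha>] F_def dec_enc)
  have "act P (Ob \<beta>) (on_Ob g) (comp_over P \<alpha> \<beta> \<xi> \<mu>) =
    family_comp P (Ob \<alpha>) (\<lambda>u. on_Ob g ` F u) \<xi> (\<lambda>u. act P (F u) (on_Ob g) (\<mu> (dec u)))"
    using family_comp_natural[OF F inj assms(2) \<mu>]
    by (simp add: comp_over_eq_family_comp[OF S] UF F_def[symmetric])
  also have "\<dots> = family_comp P (on_Ob g ` Ob \<alpha>) (\<lambda>u. Ob (restr \<beta>' (dec u)))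
      (act P (Ob \<alpha>) (on_Ob g) \<xi>) (\<lambda>u. \<mu>' (dec u))"
  proof (rule family_comp_reindex[OF block_family_image[OF F inj] _ assms(2), symmetric])
    show "inj_on (on_Ob g) (Ob \<alpha>)" using g\<alpha> by (simp add: bij_betw_def)
    fix u assume "u \<in> Ob \<alpha>"
    then obtain T where T: "T \<in> \<alpha>" "u = enc T" by (auto simp: Ob_def)
    have gT: "dec (on_Ob g u) = g T"
      using T g(1) fin\<alpha> fin\<alpha>' by (auto simp: on_Ob_enc bij_betw_def dec_enc)
    have "on_Ob g ` Ob (restr \<beta> T) = Ob (g ` restr \<beta> T)"
      using fin\<alpha> by (intro on_Ob_image_Ob) (auto simp: restr_def)
    then show "Ob (restr \<beta>' (dec (on_Ob g u))) = on_Ob g ` F u"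
      using T gT restr fin\<alpha> by (simp add: F_def dec_enc)
    show "\<mu>' (dec (on_Ob g u)) = act P (F u) (on_Ob g) (\<mu> (dec u))"
      using T gT assms(4) fin\<alpha> by (simp add: F_def dec_enc)
  qed
  also have "\<dots> = comp_over P \<alpha>' \<beta>' (act P (Ob \<alpha>) (on_Ob g) \<xi>) \<mu>'"
    using g\<alpha> by (simp add: comp_over_eq_family_comp[OF S'] bij_betw_def)
  finally show ?thesis .
qed

text \<open>\<open>family_comp_assoc\<close> with codes as labels. Inside a block T the family \<nu>
  can be used unchanged, because restricting \<gamma> first to T and then to V \<subseteq> T is
  restricting it to V.\<close>

lemma comp_over_assoc:
  assumes "fin S" "refines S \<beta> \<alpha>" "refines S \<gamma> \<beta>" "\<xi> \<in> carr P (Ob \<alpha>)"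
    and \<mu>: "\<And>T. T \<in> \<alpha> \<Longrightarrow> \<mu> T \<in> carr P (Ob (restr \<beta> T))"
    and \<nu>: "\<And>V. V \<in> \<beta> \<Longrightarrow> \<nu> V \<in> carr P (Ob (restr \<gamma> V))"
  shows "comp_over P \<beta> \<gamma> (comp_over P \<alpha> \<beta> \<xi> \<mu>) \<nu> =
    comp_over P \<alpha> \<gamma> \<xi> (\<lambda>T. comp_over P (restr \<beta> T) (restr \<gamma> T) (\<mu> T) \<nu>)"
proof -
  have \<gamma>\<alpha>: "refines S \<gamma> \<alpha>" using refines_trans assms(2,3) by blast
  have p: "partition_on S \<alpha>" "partition_on S \<beta>" using assms(2) by (auto simp: refines_def)
  have fin\<alpha>: "finite T" if "T \<in> \<alpha> \<or> T \<in> \<beta>" for T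
    using finite_block[OF assms(1)] p that by blast
  define F where "F = (\<lambda>u. Ob (restr \<beta> (dec u)))"
  define G where "G = (\<lambda>u. Ob (restr \<gamma> (dec u)))"
  have F: "block_family (Ob \<alpha>) F" unfolding F_def using block_family_restr[OF assms(1,2)] .
  have G: "block_family (Ob \<beta>) G" unfolding G_def using block_family_restr[OF assms(1,3)] .
  have UF: "Ob \<beta> = (\<Union>u\<in>Ob \<alpha>. F u)" unfolding F_def using Union_Ob_restr[OF assms(1,2)] by simp
  have \<mu>': "\<mu> (dec u) \<in> carr P (F u)" if "u \<in> Ob \<alpha>" for u
    using that \<mu> fin\<alpha> by (auto simp: Ob_def[of \<alpha>] F_def dec_enc)
  have \<nu>': "\<nu> (dec u) \<in> carr P (G u)" if "u \<in> Ob \<beta>" for u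
    using that \<nu> fin\<alpha> by (auto simp: Ob_def[of \<beta>] G_def dec_enc)
  have FG: "block_family (Ob \<alpha>) (\<lambda>u. \<Union>k\<in>F u. G k)"
    using block_family_Union F G UF by simp
  have "comp_over P \<beta> \<gamma> (comp_over P \<alpha> \<beta> \<xi> \<mu>) \<nu> =
    family_comp P (Ob \<alpha>) (\<lambda>u. \<Union>k\<in>F u. G k) \<xi>
      (\<lambda>u. family_comp P (F u) G (\<mu> (dec u)) (\<lambda>k. \<nu> (dec k)))"
    using family_comp_assoc[OF F UF G assms(4) \<mu>' \<nu>']
    by (simp add: comp_over_eq_family_comp[OF assms(1,2)] comp_over_eq_family_comp[OF assms(1,3)]
      F_def[symmetric] G_def[symmetric])
  also have "\<dots> = family_comp P (Ob \<alpha>) G \<xi>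
      (\<lambda>u. comp_over P (restr \<beta> (dec u)) (restr \<gamma> (dec u)) (\<mu> (dec u)) \<nu>)"
  proof (rule family_comp_cong[OF FG assms(4), symmetric])
    fix u assume "u \<in> Ob \<alpha>"
    then obtain T where T: "T \<in> \<alpha>" "dec u = T" using fin\<alpha> by (auto simp: Ob_def dec_enc)
    note ref = fin_block[OF assms(1) p(1) T(1)] refines_restr[OF assms(2,3) T(1)]
    have eq: "Ob (restr (restr \<gamma> T) (dec k)) = G k" if "k \<in> F u" for k
    proof -
      have "dec k \<subseteq> T" using that T fin\<alpha> by (auto simp: F_def Ob_def restr_def dec_enc)
      then show ?thesis by (simp add: restr_restr G_def)
    qed
    then have "(\<Union>k\<in>F u. G k) = (\<Union>k\<in>Ob (restr \<beta> T). Ob (restr (restr \<gamma> T) (dec k)))"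
      using T by (simp add: F_def)
    then show "G u = (\<Union>k\<in>F u. G k)" using Union_Ob_restr[OF ref] T by (simp add: G_def)
    have "family_comp P (F u) (\<lambda>k. Ob (restr (restr \<gamma> T) (dec k))) (\<mu> T) (\<lambda>k. \<nu> (dec k)) =
        family_comp P (F u) G (\<mu> T) (\<lambda>k. \<nu> (dec k))"
    proof (rule family_comp_cong)
      show "block_family (F u) G"
        using block_family_subset[OF G, of "F u"] UF \<open>u \<in> Ob \<alpha>\<close> F
        by (auto simp: block_family_def fin_def)
      show "\<mu> T \<in> carr P (F u)" using \<mu>[OF T(1)] T by (simp add: F_def)
    qed (use eq in auto)
    then show "comp_over P (restr \<beta> (dec u)) (restr \<gamma> (dec u)) (\<mu> (dec u)) \<nu> =
        family_comp P (F u) G (\<mu> (dec u)) (\<lambda>k. \<nu> (dec k))"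
      using T by (simp add: comp_over_eq_family_comp[OF ref] F_def)
  qed
  also have "\<dots> = comp_over P \<alpha> \<gamma> \<xi> (\<lambda>T. comp_over P (restr \<beta> T) (restr \<gamma> T) (\<mu> T) \<nu>)"
    by (simp add: comp_over_eq_family_comp[OF assms(1) \<gamma>\<alpha>] G_def)
  finally show ?thesis .
qed

lemma comp_over_unit_left:
  assumes "fin S" "partition_on S \<pi>" "\<mu> S \<in> carr P (Ob \<pi>)"
  shows "comp_over P {S} \<pi> (unit P (enc S)) \<mu> = \<mu> S"
proof -
  have "dec (enc S) = S" using assms(1) by (simp add: fin_def dec_enc)
  then show ?thesis
    using family_comp_unit_left[of "\<lambda>u. Ob (restr \<pi> (dec u))" "enc S" "\<mu> S" "\<lambda>u. \<mu> (dec u)"]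
      assms fin_Ob_partition[OF assms(1,2)]
    by (simp add: comp_over_eq_family_comp[OF assms(1) refines_whole[OF assms(1,2)]]
        restr_whole[OF assms(2)] Ob_def[of "{S}"])
qed

text \<open>Each block contains only itself, so every inner block of codes is a singleton and the
  unit law for families applies with the identity relabelling.\<close>

lemma comp_over_unit_right:
  assumes "fin S" "partition_on S \<pi>" "\<xi> \<in> carr P (Ob \<pi>)"
  shows "comp_over P \<pi> \<pi> \<xi> (\<lambda>T. unit P (enc T)) = \<xi>"
proof -
  have fin\<pi>: "finite T" if "T \<in> \<pi>" for T using finite_block assms that by blast
  note J = fin_Ob_partition[OF assms(1,2)]
  have F: "block_family (Ob \<pi>) (\<lambda>u. {u})"
    using J by (auto simp: block_family_def fin_def disjoint_family_on_def)
  have "comp_over P \<pi> \<pi> \<xi> (\<lambda>T. unit P (enc T)) =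
    family_comp P (Ob \<pi>) (\<lambda>u. {u}) \<xi> (unit P)"
    unfolding comp_over_eq_family_comp[OF assms(1) refines_refl[OF assms(2)]]
    by (rule family_comp_cong[OF F assms(3)])
      (auto simp: Ob_def dec_enc fin\<pi> restr_self[OF assms(2)])
  also have "\<dots> = \<xi>"
    using family_comp_unit_right[of "Ob \<pi>" "\<lambda>u. u" \<xi>] J assms(3) by (simp add: act_id)
  finally show ?thesis .
qed

lemma comp_over_inject:
  assumes "left_basic P" "fin S" "refines S \<beta> \<alpha>" "\<xi> \<in> carr P (Ob \<alpha>)"
    and "\<And>T. T \<in> \<alpha> \<Longrightarrow> \<mu> T \<in> carr P (Ob (restr \<beta> T))"
    and "\<And>T. T \<in> \<alpha> \<Longrightarrow> \<mu>' T \<in> carr P (Ob (restr \<beta> T))"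
    and "comp_over P \<alpha> \<beta> \<xi> \<mu> = comp_over P \<alpha> \<beta> \<xi> \<mu>'" "T \<in> \<alpha>"
  shows "\<mu> T = \<mu>' T"
proof -
  have fin\<alpha>: "finite T" if "T \<in> \<alpha>" for T
    using finite_block[OF assms(2)] assms(3) that by (auto simp: refines_def)
  have "\<mu> (dec (enc T)) = \<mu>' (dec (enc T))"
    by (rule family_comp_inject[OF assms(1) block_family_restr[OF assms(2,3)] assms(4)])
      (use assms(5-8) fin\<alpha> in \<open>auto simp: comp_over_eq_family_comp[OF assms(2,3)] Ob_def[of \<alpha>] dec_enc\<close>)
  then show ?thesis using fin\<alpha> assms(8) by (simp add: dec_enc)
qed

end

section \<open>The order and \<psi> in terms of families\<close>

lemma carr_left_dec [simp]:
  "(\<pi>, \<xi>) \<in> carr (left_dec P) S \<longleftrightarrow> partition_on S \<pi> \<and> \<xi> \<in> carr P (Ob \<pi>)"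
  by (simp add: left_dec_def)

lemma act_left_dec [simp]:
  "act (left_dec P) S f (\<pi>, \<xi>) = ((`) f ` \<pi>, act P (Ob \<pi>) (on_Ob ((`) f)) \<xi>)"
  by (simp add: left_dec_def)

lemma left_dec_phi_eq [simp]:
  "left_dec_phi P S (\<pi>, \<xi>) (\<alpha>, \<mu>) = (quot \<alpha> \<pi>, act P (Ob \<alpha>) (on_Ob (\<lambda>T. Ob (restr \<pi> T))) \<mu>)"
  by (simp add: left_dec_phi_def)

lemma le_left_dec_refines:
  "le (left_dec P) S (\<alpha>, \<xi>) (\<beta>, \<eta>) \<Longrightarrow> refines S \<beta> \<alpha>"
  by (simp add: left_dec_def Part_def)

context set_operad
begin

lemma le_left_decI:
  assumes "fin S" "refines S \<beta> \<alpha>" "\<And>T. T \<in> \<alpha> \<Longrightarrow> \<mu> T \<in> carr P (Ob (restr \<beta> T))"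
    and "\<eta> = comp_over P \<alpha> \<beta> \<xi> \<mu>"
  shows "le (left_dec P) S (\<alpha>, \<xi>) (\<beta>, \<eta>)"
proof -
  have "\<eta> = comp_over P \<alpha> \<beta> \<xi> (restrict \<mu> \<alpha>)"
    using comp_over_cong[OF assms(1,2), of \<mu> "restrict \<mu> \<alpha>"] assms(4) by simp
  then show ?thesis using assms(2,3) by (auto simp: left_dec_def Part_def)
qed

lemma le_left_decE:
  assumes "le (left_dec P) S (\<alpha>, \<xi>) (\<beta>, \<eta>)"
  obtains \<mu> where "refines S \<beta> \<alpha>" "\<And>T. T \<in> \<alpha> \<Longrightarrow> \<mu> T \<in> carr P (Ob (restr \<beta> T))"
    "\<eta> = comp_over P \<alpha> \<beta> \<xi> \<mu>"
  using assms by (auto simp: left_dec_def Part_def)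

lemma refinement_iso_act_in:
  assumes "refinement_iso g S \<alpha> \<beta> S' \<alpha>' \<beta>'" "T \<in> \<alpha>" "x \<in> carr P (Ob (restr \<beta> T))"
  shows "act P (Ob (restr \<beta> T)) (on_Ob g) x \<in> carr P (Ob (restr \<beta>' (g T)))"
proof -
  have S: "fin S" "refines S \<beta> \<alpha>" "fin S'" "refines S' \<beta>' \<alpha>'" "bij_betw g \<beta> \<beta>'"
    and restr: "restr \<beta>' (g T) = g ` restr \<beta> T"
    using assms by (auto simp: refinement_iso_def)
  have "bij_betw g (restr \<beta> T) (g ` restr \<beta> T)"
    using S(5) by (auto simp: bij_betw_def restr_def intro: inj_on_subset)
  moreover have "finite B" if "B \<in> restr \<beta> T" for B
    using finite_block[OF S(1), of \<beta>] S(2) that by (auto simp: refines_def restr_def)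
  moreover have "finite B" if "B \<in> g ` restr \<beta> T" for B
    using finite_block[OF S(3), of \<beta>'] S(4) that restr by (auto simp: refines_def restr_def)
  ultimately have "bij_betw (on_Ob g) (Ob (restr \<beta> T)) (Ob (restr \<beta>' (g T)))"
    unfolding restr by (intro bij_betw_on_Ob)
  then show ?thesis
    using act_in fin_Ob[OF fin_restr[OF S(1,2) assms(2)]] assms(3) by blast
qed

text \<open>Used twice: for a bijection it gives monotonicity of the action, for a quotient it gives
  monotonicity of \<phi>.\<close>

lemma le_left_dec_transport:
  assumes "refinement_iso g S \<alpha> \<beta> S' \<alpha>' \<beta>'" "\<xi> \<in> carr P (Ob \<alpha>)"
    and "le (left_dec P) S (\<alpha>, \<xi>) (\<beta>, \<eta>)"
  shows "le (left_dec P) S' (\<alpha>', act P (Ob \<alpha>) (on_Ob g) \<xi>) (\<beta>', act P (Ob \<beta>) (on_Ob g) \<eta>)"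
proof -
  obtain \<mu> where \<mu>: "\<And>T. T \<in> \<alpha> \<Longrightarrow> \<mu> T \<in> carr P (Ob (restr \<beta> T))" and \<eta>: "\<eta> = comp_over P \<alpha> \<beta> \<xi> \<mu>"
    using assms(3) by (blast elim: le_left_decE)
  \<comment> \<open>The witness over \<alpha>' must be a function of the new blocks, so each is
    first sent back through the inverse of g.\<close>
  define \<mu>' where "\<mu>' = (\<lambda>U. act P (Ob (restr \<beta> (the_inv_into \<alpha> g U))) (on_Ob g) (\<mu> (the_inv_into \<alpha> g U)))"
  have S': "fin S'" "refines S' \<beta>' \<alpha>'" "bij_betw g \<alpha> \<alpha>'"
    using assms(1) by (auto simp: refinement_iso_def)
  have \<mu>': "\<mu>' (g T) = act P (Ob (restr \<beta> T)) (on_Ob g) (\<mu> T)" if "T \<in> \<alpha>" for T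
    using that S'(3) by (simp add: \<mu>'_def the_inv_into_f_f bij_betw_def)
  have "\<mu>' U \<in> carr P (Ob (restr \<beta>' U))" if "U \<in> \<alpha>'" for U
    using that S'(3) \<mu>' refinement_iso_act_in[OF assms(1) _ \<mu>] by (auto simp: bij_betw_def)
  then show ?thesis
    by (rule le_left_decI[OF S'(1,2)])
      (simp_all add: \<eta> comp_over_transport[OF assms(1,2) \<mu> \<mu>'])
qed

text \<open>Evaluates the definite description. It ranges over extensional families, so \<mu> is cut
  off to \<pi>; left-basicness excludes any other candidate.\<close>

lemma left_dec_psi_eq:
  assumes "left_basic P" "fin S" "refines S \<beta> \<pi>" "\<xi> \<in> carr P (Ob \<pi>)"
    and "\<And>T. T \<in> \<pi> \<Longrightarrow> \<mu> T \<in> carr P (Ob (restr \<beta> T))"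
  shows "left_dec_psi P S (\<pi>, \<xi>) (\<beta>, comp_over P \<pi> \<beta> \<xi> \<mu>) = (\<lambda>T\<in>\<pi>. (restr \<beta> T, \<mu> T))"
proof -
  have "(THE \<mu>'. \<mu>' \<in> (\<Pi>\<^sub>E T\<in>\<pi>. carr P (Ob (restr \<beta> T))) \<and>
      comp_over P \<pi> \<beta> \<xi> \<mu> = comp_over P \<pi> \<beta> \<xi> \<mu>') = restrict \<mu> \<pi>"
  proof (rule the_equality)
    show "restrict \<mu> \<pi> \<in> (\<Pi>\<^sub>E T\<in>\<pi>. carr P (Ob (restr \<beta> T))) \<and>
        comp_over P \<pi> \<beta> \<xi> \<mu> = comp_over P \<pi> \<beta> \<xi> (restrict \<mu> \<pi>)"
      using assms(5) comp_over_cong[OF assms(2,3), of \<mu> "restrict \<mu> \<pi>"] by auto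
    fix \<mu>' assume \<mu>': "\<mu>' \<in> (\<Pi>\<^sub>E T\<in>\<pi>. carr P (Ob (restr \<beta> T))) \<and>
      comp_over P \<pi> \<beta> \<xi> \<mu> = comp_over P \<pi> \<beta> \<xi> \<mu>'"
    show "\<mu>' = restrict \<mu> \<pi>"
    proof (rule PiE_ext)
      show "\<mu>' \<in> (\<Pi>\<^sub>E T\<in>\<pi>. carr P (Ob (restr \<beta> T)))" using \<mu>' by blast
      show "restrict \<mu> \<pi> \<in> (\<Pi>\<^sub>E T\<in>\<pi>. carr P (Ob (restr \<beta> T)))" using assms(5) by auto
      show "\<mu>' T = restrict \<mu> \<pi> T" if "T \<in> \<pi>" for T
      proof -
        have "\<mu>' V \<in> carr P (Ob (restr \<beta> V))" if "V \<in> \<pi>" for V using \<mu>' that by blast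
        then have "\<mu> T = \<mu>' T"
          using \<mu>' that by (intro comp_over_inject[OF assms(1-5)]) auto
        then show ?thesis using that by simp
      qed
    qed
  qed
  then show ?thesis by (auto simp: left_dec_psi_def)
qed

text \<open>The transported family composes to the transported \<eta>, hence is the one that \<psi>
  selects. Bijections give equivariance, quotients give the interchange with \<phi>.\<close>

lemma left_dec_psi_transport:
  assumes "left_basic P" "refinement_iso g S \<alpha> \<beta> S' \<alpha>' \<beta>'" "\<xi> \<in> carr P (Ob \<alpha>)"
    and "le (left_dec P) S (\<alpha>, \<xi>) (\<beta>, \<eta>)" "T \<in> \<alpha>"
  shows "left_dec_psi P S' (\<alpha>', act P (Ob \<alpha>) (on_Ob g) \<xi>) (\<beta>', act P (Ob \<beta>) (on_Ob g) \<eta>) (g T) =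
    (restr \<beta>' (g T), act P (Ob (restr \<beta> T)) (on_Ob g) (snd (left_dec_psi P S (\<alpha>, \<xi>) (\<beta>, \<eta>) T)))"
proof -
  obtain \<mu> where \<mu>: "\<And>T. T \<in> \<alpha> \<Longrightarrow> \<mu> T \<in> carr P (Ob (restr \<beta> T))" and \<eta>: "\<eta> = comp_over P \<alpha> \<beta> \<xi> \<mu>"
    using assms(4) by (blast elim: le_left_decE)
  define \<mu>' where "\<mu>' = (\<lambda>U. act P (Ob (restr \<beta> (the_inv_into \<alpha> g U))) (on_Ob g) (\<mu> (the_inv_into \<alpha> g U)))"
  have S: "fin S" "refines S \<beta> \<alpha>" and S': "fin S'" "refines S' \<beta>' \<alpha>'" "bij_betw g \<alpha> \<alpha>'"
    using assms(2) by (auto simp: refinement_iso_def)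
  have \<mu>': "\<mu>' (g T) = act P (Ob (restr \<beta> T)) (on_Ob g) (\<mu> T)" if "T \<in> \<alpha>" for T
    using that S'(3) by (simp add: \<mu>'_def the_inv_into_f_f bij_betw_def)
  have "\<mu>' U \<in> carr P (Ob (restr \<beta>' U))" if "U \<in> \<alpha>'" for U
    using that S'(3) \<mu>' refinement_iso_act_in[OF assms(2) _ \<mu>] by (auto simp: bij_betw_def)
  moreover have "act P (Ob \<alpha>) (on_Ob g) \<xi> \<in> carr P (Ob \<alpha>')"
  proof (rule act_in[OF _ bij_betw_on_Ob[OF _ _ S'(3)] assms(3)])
    show "fin (Ob \<alpha>)" using fin_Ob_partition[OF S(1)] S(2) by (simp add: refines_def)
    show "finite T" if "T \<in> \<alpha>" for T using finite_block[OF S(1)] S(2) that by (auto simp: refines_def)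
    show "finite T" if "T \<in> \<alpha>'" for T using finite_block[OF S'(1)] S'(2) that by (auto simp: refines_def)
  qed
  ultimately show ?thesis
    using left_dec_psi_eq[OF assms(1) S'(1,2), of _ \<mu>'] left_dec_psi_eq[OF assms(1) S assms(3) \<mu>]
      comp_over_transport[OF assms(2,3) \<mu> \<mu>'] \<mu>'[OF assms(5)] S'(3) assms(5)
    by (simp add: \<eta> bij_betw_apply)
qed

end

section \<open>The poset species of left-decorated partitions\<close>

locale left_basic_operad = set_operad P
  for P :: "('a hf, 'o, 'm) operad_data_scheme" +
  assumes left_basic: "left_basic P"
    and finite_carr: "finite S \<Longrightarrow> finite (carr P S)"
    and carr_singleton: "carr P {s} = {unit P s}"
    and carr_nonempty: "fin S \<Longrightarrow> carr P S \<noteq> {}"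
begin

lemma species_left_dec: "species (left_dec P)"
proof
  fix S S' :: "'a hf set" and f g :: "'a hf \<Rightarrow> 'a hf" and x :: "'a hf set set \<times> 'o"
  assume S: "fin S" and x: "x \<in> carr (left_dec P) S"
  obtain \<pi> \<xi> where x_def: "x = (\<pi>, \<xi>)" by (cases x)
  have \<pi>: "partition_on S \<pi>" and \<xi>: "\<xi> \<in> carr P (Ob \<pi>)" using x by (simp_all add: x_def)
  have fin\<pi>: "finite T" if "T \<in> \<pi>" for T using finite_block[OF S \<pi>] that .
  note finOb = fin_Ob_partition[OF S \<pi>] and fpi = fin_partition[OF S \<pi>]
  show "act (left_dec P) S (\<lambda>s. s) x = x"
  proof -
    have "on_Ob ((`) (\<lambda>s. s)) u = u" if "u \<in> Ob \<pi>" for u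
      using that fin\<pi> by (auto simp: Ob_def on_Ob_enc)
    then show ?thesis using act_eq_id[OF finOb _ \<xi>] by (simp add: x_def)
  qed
  {
    assume f: "bij_betw f S S'"
    show "act (left_dec P) S f x \<in> carr (left_dec P) S'"
      using act_in[OF finOb bij_betw_on_Ob[OF _ _ bij_betw_image_partition[OF f \<pi>]] \<xi>]
        fin\<pi> partition_on_image[OF f \<pi>] by (auto simp: x_def)
  }
  {
    assume f: "inj_on f S" and eq: "\<And>s. s \<in> S \<Longrightarrow> f s = g s"
    have "f ` T = g ` T" if "T \<in> \<pi>" for T
      using eq \<pi> that by (intro image_cong) (auto simp: partition_on_def)
    then show "act (left_dec P) S f x = act (left_dec P) S g x"
      using act_on_Ob_cong[OF fpi fin\<pi> _ inj_on_image_partition[OF f \<pi>] _ \<xi>, of "(`) g"] fin\<pi>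
      by (auto simp: x_def)
  }
next
  fix S S' S'' :: "'a hf set" and f g and x :: "'a hf set set \<times> 'o"
  assume S: "fin S" and x: "x \<in> carr (left_dec P) S"
    and f: "bij_betw f S S'" and g: "bij_betw g S' S''"
  obtain \<pi> \<xi> where x_def: "x = (\<pi>, \<xi>)" by (cases x)
  have \<pi>: "partition_on S \<pi>" and \<xi>: "\<xi> \<in> carr P (Ob \<pi>)" using x by (simp_all add: x_def)
  have fin\<pi>: "finite T" if "T \<in> \<pi>" for T using finite_block[OF S \<pi>] that .
  have "inj_on ((`) f) \<pi>" "inj_on ((`) g) ((`) f ` \<pi>)"
    using bij_betw_image_partition[OF f \<pi>] bij_betw_image_partition[OF g partition_on_image[OF f \<pi>]]
    by (simp_all add: bij_betw_def)
  then have "act P (Ob ((`) f ` \<pi>)) (on_Ob ((`) g)) (act P (Ob \<pi>) (on_Ob ((`) f)) \<xi>) =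
      act P (Ob \<pi>) (on_Ob ((`) g \<circ> (`) f)) \<xi>"
    using fin\<pi> by (intro act_on_Ob_act_on_Ob[OF fin_partition[OF S \<pi>] fin\<pi> _ _ _ _ \<xi>]) auto
  moreover have "(`) g \<circ> (`) f = (`) (g \<circ> f)" by (auto simp: image_comp)
  ultimately show "act (left_dec P) S (g \<circ> f) x = act (left_dec P) S' g (act (left_dec P) S f x)"
    by (auto simp: x_def image_comp)
qed

text \<open>Each \<mu> T is an operation on the single point \<open>enc T\<close>, hence the unit,
  so this is the right unit law. Here triviality of P(1) makes the order antisymmetric.\<close>

lemma comp_over_same:
  assumes "fin S" "partition_on S \<pi>" "\<xi> \<in> carr P (Ob \<pi>)"
    and "\<And>T. T \<in> \<pi> \<Longrightarrow> \<mu> T \<in> carr P (Ob (restr \<pi> T))"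
  shows "comp_over P \<pi> \<pi> \<xi> \<mu> = \<xi>"
proof -
  have "\<mu> T = unit P (enc T)" if "T \<in> \<pi>" for T
    using assms(4)[OF that] restr_self[OF assms(2) that] by (simp add: Ob_def carr_singleton)
  then show ?thesis
    using comp_over_cong[OF assms(1) refines_refl[OF assms(2)], of \<mu> "\<lambda>T. unit P (enc T)"]
      comp_over_unit_right[OF assms(1-3)] by simp
qed

lemma le_left_dec_eq:
  assumes "fin S" "\<xi> \<in> carr P (Ob \<pi>)" "le (left_dec P) S (\<pi>, \<xi>) (\<pi>, \<eta>)"
  shows "\<eta> = \<xi>"
  using assms(3) by (rule le_left_decE) (use comp_over_same assms in \<open>auto simp: refines_def\<close>)

lemma le_left_dec_refl:
  assumes "fin S" "partition_on S \<pi>" "\<xi> \<in> carr P (Ob \<pi>)"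
  shows "le (left_dec P) S (\<pi>, \<xi>) (\<pi>, \<xi>)"
proof (rule le_left_decI[OF assms(1) refines_refl[OF assms(2)]])
  show unit: "unit P (enc T) \<in> carr P (Ob (restr \<pi> T))" if "T \<in> \<pi>" for T
    using restr_self[OF assms(2) that] by (simp add: Ob_def carr_singleton)
  show "\<xi> = comp_over P \<pi> \<pi> \<xi> (\<lambda>T. unit P (enc T))"
    using comp_over_unit_right[OF assms] by simp
qed

text \<open>Keeps the witnesses of both comparisons next to the witness they induce for the
  composite one. Transitivity needs only the latter; the laws for \<psi> need how it factors through
  \<mu> and \<nu>.\<close>

lemma le_left_dec_compose:
  assumes "fin S" "\<xi> \<in> carr P (Ob \<alpha>)"
    and "le (left_dec P) S (\<alpha>, \<xi>) (\<beta>, \<eta>)" "le (left_dec P) S (\<beta>, \<eta>) (\<gamma>, \<zeta>)"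
  obtains \<mu> \<nu> where "refines S \<beta> \<alpha>" "refines S \<gamma> \<beta>" "refines S \<gamma> \<alpha>"
    and "\<And>T. T \<in> \<alpha> \<Longrightarrow> \<mu> T \<in> carr P (Ob (restr \<beta> T))"
    and "\<And>V. V \<in> \<beta> \<Longrightarrow> \<nu> V \<in> carr P (Ob (restr \<gamma> V))"
    and "\<And>T. T \<in> \<alpha> \<Longrightarrow> comp_over P (restr \<beta> T) (restr \<gamma> T) (\<mu> T) \<nu> \<in> carr P (Ob (restr \<gamma> T))"
    and "\<eta> = comp_over P \<alpha> \<beta> \<xi> \<mu>" "\<zeta> = comp_over P \<beta> \<gamma> \<eta> \<nu>"
    and "\<zeta> = comp_over P \<alpha> \<gamma> \<xi> (\<lambda>T. comp_over P (restr \<beta> T) (restr \<gamma> T) (\<mu> T) \<nu>)"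
proof -
  obtain \<mu> where \<mu>: "refines S \<beta> \<alpha>" "\<And>T. T \<in> \<alpha> \<Longrightarrow> \<mu> T \<in> carr P (Ob (restr \<beta> T))"
      "\<eta> = comp_over P \<alpha> \<beta> \<xi> \<mu>"
    using assms(3) by (blast elim: le_left_decE)
  obtain \<nu> where \<nu>: "refines S \<gamma> \<beta>" "\<And>T. T \<in> \<beta> \<Longrightarrow> \<nu> T \<in> carr P (Ob (restr \<gamma> T))"
      "\<zeta> = comp_over P \<beta> \<gamma> \<eta> \<nu>"
    using assms(4) by (blast elim: le_left_decE)
  have in_T: "comp_over P (restr \<beta> T) (restr \<gamma> T) (\<mu> T) \<nu> \<in> carr P (Ob (restr \<gamma> T))" if T: "T \<in> \<alpha>" for T
  proof (rule comp_over_in[OF _ refines_restr[OF \<mu>(1) \<nu>(1) T] \<mu>(2)[OF T]])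
    show "fin T" using fin_block[OF assms(1) _ T] \<mu>(1) by (auto simp: refines_def)
    show "\<nu> V \<in> carr P (Ob (restr (restr \<gamma> T) V))" if "V \<in> restr \<beta> T" for V
      using that \<nu>(2) by (simp add: restr_restr restr_def[of \<beta>])
  qed
  have "\<zeta> = comp_over P \<alpha> \<gamma> \<xi> (\<lambda>T. comp_over P (restr \<beta> T) (restr \<gamma> T) (\<mu> T) \<nu>)"
    using comp_over_assoc[OF assms(1) \<mu>(1) \<nu>(1) assms(2) \<mu>(2) \<nu>(2)] \<mu>(3) \<nu>(3) by simp
  then show ?thesis
    using that[OF \<mu>(1) \<nu>(1) refines_trans[OF \<nu>(1) \<mu>(1)] \<mu>(2) \<nu>(2) in_T \<mu>(3) \<nu>(3)] by blast
qed

lemma finite_poset_left_dec: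
  assumes S: "fin S"
  shows "finite_poset (carr (left_dec P) S) (le (left_dec P) S)"
  unfolding finite_poset_def
proof (intro conjI)
  \<comment> \<open>A finite union of finite fibres: finitely many partitions, each with finitely
    many decorations.\<close>
  have "carr (left_dec P) S = (SIGMA \<pi>:{\<pi>. partition_on S \<pi>}. carr P (Ob \<pi>))"
    by (auto simp: left_dec_def)
  moreover have "finite (carr P (Ob \<pi>))" if "partition_on S \<pi>" for \<pi>
    using fin_Ob_partition[OF S that] finite_carr by (simp add: fin_def)
  ultimately show "finite (carr (left_dec P) S)"
    using S finitely_many_partition_on[of S] by (auto simp: fin_def)
  show "reflp_on (carr (left_dec P) S) (le (left_dec P) S)"
    using le_left_dec_refl[OF S] by (auto intro!: reflp_onI)
  show "antisymp_on (carr (left_dec P) S) (le (left_dec P) S)"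
  proof (rule antisymp_onI)
    fix x y assume x: "x \<in> carr (left_dec P) S" "y \<in> carr (left_dec P) S"
      and le: "le (left_dec P) S x y" "le (left_dec P) S y x"
    obtain \<alpha> \<xi> \<beta> \<eta> where xy: "x = (\<alpha>, \<xi>)" "y = (\<beta>, \<eta>)" by (cases x, cases y)
    \<comment> \<open>Antisymmetry of refinement settles the partitions; the decorations are then
      compared over one and the same partition.\<close>
    then have "\<alpha> = \<beta>" using le le_left_dec_refines refines_asym by metis
    then show "x = y" using le_left_dec_eq[OF S] x le by (auto simp: xy)
  qed
  show "transp_on (carr (left_dec P) S) (le (left_dec P) S)"
  proof (rule transp_onI)
    fix x y z assume x: "x \<in> carr (left_dec P) S"
      and le: "le (left_dec P) S x y" "le (left_dec P) S y z"
    obtain \<alpha> \<xi> \<beta> \<eta> \<gamma> \<zeta> where xyz: "x = (\<alpha>, \<xi>)" "y = (\<beta>, \<eta>)" "z = (\<gamma>, \<zeta>)"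
      by (cases x, cases y, cases z)
    have \<xi>: "\<xi> \<in> carr P (Ob \<alpha>)" using x xyz by simp
    show "le (left_dec P) S x z"
      using le unfolding xyz by (rule le_left_dec_compose[OF S \<xi>]) (rule le_left_decI[OF S])
  qed
qed

lemma poset_species_left_dec: "poset_species (left_dec P)"
proof (rule poset_species.intro[OF species_left_dec], unfold_locales)
  fix S S' :: "'a hf set" and f
  assume S: "fin S"
  show "finite_poset (carr (left_dec P) S) (le (left_dec P) S)"
    using finite_poset_left_dec[OF S] .
  assume f: "bij_betw f S S'"
  show "monotone_on (carr (left_dec P) S) (le (left_dec P) S) (le (left_dec P) S') (act (left_dec P) S f)"
  proof (rule monotone_onI)
    fix x y assume x: "x \<in> carr (left_dec P) S" and le: "le (left_dec P) S x y"
    obtain \<alpha> \<xi> \<beta> \<eta> where xy: "x = (\<alpha>, \<xi>)" "y = (\<beta>, \<eta>)" by (cases x, cases y)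
    then have "refines S \<beta> \<alpha>" using le le_left_dec_refines by simp
    then show "le (left_dec P) S' (act (left_dec P) S f x) (act (left_dec P) S f y)"
      using x le le_left_dec_transport[OF refinement_iso_image[OF S f]] by (simp add: xy)
  qed
qed

section \<open>Minimal and maximal elements\<close>

lemma minimal_elts_left_dec:
  assumes S: "fin S"
  shows "minimal_elts (carr (left_dec P) S) (le (left_dec P) S) = {({S}, unit P (enc S))}"
proof -
  have p: "partition_on S {S}" using S by (auto simp: fin_def partition_on_def)
  have Ob: "Ob {S} = {enc S}" by (simp add: Ob_def)
  \<comment> \<open>Every \<xi> is the unit composed with \<xi> itself, so the constant family \<xi>
    witnesses the comparison.\<close>
  have bot: "le (left_dec P) S ({S}, unit P (enc S)) x" if x_in: "x \<in> carr (left_dec P) S" for x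
  proof -
    obtain \<pi> \<xi> where x: "x = (\<pi>, \<xi>)" "partition_on S \<pi>" "\<xi> \<in> carr P (Ob \<pi>)"
      using x_in by (cases x) auto
    then show ?thesis
      using restr_whole[OF x(2)] comp_over_unit_left[OF S x(2), of "\<lambda>_. \<xi>"]
      unfolding x(1) by (intro le_left_decI[OF S refines_whole[OF S x(2)], of "\<lambda>_. \<xi>"]) auto
  qed
  have carr: "({S}, unit P (enc S)) \<in> carr (left_dec P) S" using p by (simp add: Ob carr_singleton)
  have "y = ({S}, unit P (enc S))"
    if "y \<in> carr (left_dec P) S" "le (left_dec P) S y ({S}, unit P (enc S))" for y
  proof -
    have "le (left_dec P) S ({S}, unit P (enc S)) y" using bot that(1) by blast
    moreover have "antisymp_on (carr (left_dec P) S) (le (left_dec P) S)"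
      using finite_poset_left_dec[OF S] by (simp add: finite_poset_def)
    ultimately show ?thesis using antisymp_onD that carr by metis
  qed
  moreover have "y = ({S}, unit P (enc S))"
    if "y \<in> minimal_elts (carr (left_dec P) S) (le (left_dec P) S)" for y
    using that bot carr unfolding minimal_elts_def by blast
  ultimately show ?thesis using carr unfolding minimal_elts_def by blast
qed

text \<open>Every decorated partition lies below one over the singletons, so a maximal element is
  already there. Conversely, nothing refines the singletons further, and over a fixed partition the
  order is equality.\<close>

lemma maximal_elts_left_dec:
  assumes S: "fin S"
  shows "maximal_elts (carr (left_dec P) S) (le (left_dec P) S) =
    {x \<in> carr (left_dec P) S. fst x = (\<lambda>s. {s}) ` S}"
proof (intro equalityI subsetI)
  let ?\<sigma> = "(\<lambda>s. {s}) ` S"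
  fix x assume "x \<in> maximal_elts (carr (left_dec P) S) (le (left_dec P) S)"
  then have x: "x \<in> carr (left_dec P) S"
    and max: "\<And>y. y \<in> carr (left_dec P) S \<Longrightarrow> le (left_dec P) S x y \<Longrightarrow> y = x"
    by (auto simp: maximal_elts_def)
  obtain \<pi> \<xi> where x_def: "x = (\<pi>, \<xi>)" by (cases x)
  have \<pi>: "partition_on S \<pi>" and \<xi>: "\<xi> \<in> carr P (Ob \<pi>)" using x by (simp_all add: x_def)
  note ref = refines_singletons[OF \<pi>]
  \<comment> \<open>An arbitrary choice of operation on the points of each block;
    \<open>carr_nonempty\<close> guarantees that there is one.\<close>
  define \<mu> where "\<mu> T = (SOME x. x \<in> carr P (Ob (restr ?\<sigma> T)))" for T
  have \<mu>: "\<mu> T \<in> carr P (Ob (restr ?\<sigma> T))" if "T \<in> \<pi>" for T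
    using carr_nonempty[OF fin_Ob[OF fin_restr[OF S ref that]]]
    unfolding \<mu>_def by (simp add: some_in_eq)
  have "(?\<sigma>, comp_over P \<pi> ?\<sigma> \<xi> \<mu>) = x"
    using comp_over_in[OF S ref \<xi> \<mu>] partition_on_singletons[of S] le_left_decI[OF S ref \<mu>]
    by (intro max) (auto simp: x_def)
  then show "x \<in> {x \<in> carr (left_dec P) S. fst x = ?\<sigma>}" using x by auto
next
  let ?\<sigma> = "(\<lambda>s. {s}) ` S"
  fix x assume x: "x \<in> {x \<in> carr (left_dec P) S. fst x = ?\<sigma>}"
  have "y = x" if y: "y \<in> carr (left_dec P) S" "le (left_dec P) S x y" for y
  proof -
    obtain \<xi> \<beta> \<eta> where xy: "x = (?\<sigma>, \<xi>)" "y = (\<beta>, \<eta>)" using x by (cases x, cases y) auto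
    have "refines S \<beta> ?\<sigma>" using y(2) le_left_dec_refines[of P S _ \<xi> \<beta> \<eta>] by (simp add: xy)
    moreover have "refines S ?\<sigma> \<beta>" using y(1) xy refines_singletons by auto
    ultimately have "\<beta> = ?\<sigma>" using refines_asym by blast
    then show ?thesis using le_left_dec_eq[OF S] x y by (auto simp: xy)
  qed
  then show "x \<in> maximal_elts (carr (left_dec P) S) (le (left_dec P) S)"
    using x by (auto simp: maximal_elts_def)
qed

section \<open>The structure maps and their laws\<close>

lemma left_dec_phi_in:
  assumes "fin S" "refines S \<pi> \<alpha>" "\<mu> \<in> carr P (Ob \<alpha>)"
  shows "left_dec_phi P S (\<pi>, \<xi>) (\<alpha>, \<mu>) \<in> carr (left_dec P) (Ob \<pi>)"
proof -
  have p: "partition_on S \<alpha>" "partition_on S \<pi>" using assms(2) by (auto simp: refines_def)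
  have "finite U" if "U \<in> quot \<alpha> \<pi>" for U
    using finite_block[OF fin_Ob_partition[OF assms(1) p(2)] partition_on_quot[OF assms(1,2)] that] .
  then have "bij_betw (on_Ob (\<lambda>T. Ob (restr \<pi> T))) (Ob \<alpha>) (Ob (quot \<alpha> \<pi>))"
    using finite_block[OF assms(1) p(1)] by (intro bij_betw_on_Ob bij_betw_quot[OF assms(1,2)])
  then show ?thesis
    using act_in[OF fin_Ob_partition[OF assms(1) p(1)] _ assms(3)] partition_on_quot[OF assms(1,2)]
    by simp
qed

lemma left_dec_psi_in:
  assumes "fin S" "\<xi> \<in> carr P (Ob \<pi>)" "le (left_dec P) S (\<pi>, \<xi>) (\<beta>, \<eta>)"
  shows "left_dec_psi P S (\<pi>, \<xi>) (\<beta>, \<eta>) \<in> (\<Pi>\<^sub>E T\<in>\<pi>. carr (left_dec P) T)"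
    and "T \<in> \<pi> \<Longrightarrow> fst (left_dec_psi P S (\<pi>, \<xi>) (\<beta>, \<eta>) T) = restr \<beta> T"
proof -
  obtain \<mu> where \<mu>: "refines S \<beta> \<pi>" "\<And>T. T \<in> \<pi> \<Longrightarrow> \<mu> T \<in> carr P (Ob (restr \<beta> T))"
      "\<eta> = comp_over P \<pi> \<beta> \<xi> \<mu>"
    using assms(3) by (blast elim: le_left_decE)
  have psi: "left_dec_psi P S (\<pi>, \<xi>) (\<beta>, \<eta>) = (\<lambda>T\<in>\<pi>. (restr \<beta> T, \<mu> T))"
    unfolding \<mu>(3) by (rule left_dec_psi_eq[OF left_basic assms(1) \<mu>(1) assms(2) \<mu>(2)])
  show "left_dec_psi P S (\<pi>, \<xi>) (\<beta>, \<eta>) \<in> (\<Pi>\<^sub>E T\<in>\<pi>. carr (left_dec P) T)"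
    unfolding psi using \<mu>(2) partition_on_restr[OF \<mu>(1)] by auto
  show "T \<in> \<pi> \<Longrightarrow> fst (left_dec_psi P S (\<pi>, \<xi>) (\<beta>, \<eta>) T) = restr \<beta> T"
    unfolding psi by simp
qed

text \<open>By associativity the family leading from \<alpha> to \<gamma> has at T the composite of
  \<mu> T with \<nu>. So \<nu> on the blocks inside T witnesses monotonicity, and by uniqueness it
  is what \<psi> finds there.\<close>

lemma left_dec_psi_chain:
  assumes "fin S" "\<xi> \<in> carr P (Ob \<alpha>)" "T \<in> \<alpha>"
    and "le (left_dec P) S (\<alpha>, \<xi>) (\<beta>, \<eta>)" "le (left_dec P) S (\<beta>, \<eta>) (\<gamma>, \<zeta>)"
  shows "le (left_dec P) T (left_dec_psi P S (\<alpha>, \<xi>) (\<beta>, \<eta>) T) (left_dec_psi P S (\<alpha>, \<xi>) (\<gamma>, \<zeta>) T)"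
    and "V \<in> restr \<beta> T \<Longrightarrow>
      left_dec_psi P T (left_dec_psi P S (\<alpha>, \<xi>) (\<beta>, \<eta>) T) (left_dec_psi P S (\<alpha>, \<xi>) (\<gamma>, \<zeta>) T) V =
      left_dec_psi P S (\<beta>, \<eta>) (\<gamma>, \<zeta>) V"
proof -
  obtain \<mu> \<nu> where ref: "refines S \<beta> \<alpha>" "refines S \<gamma> \<beta>" "refines S \<gamma> \<alpha>"
    and \<mu>: "\<And>T. T \<in> \<alpha> \<Longrightarrow> \<mu> T \<in> carr P (Ob (restr \<beta> T))"
    and \<nu>: "\<And>V. V \<in> \<beta> \<Longrightarrow> \<nu> V \<in> carr P (Ob (restr \<gamma> V))"
    and \<mu>\<nu>: "\<And>T. T \<in> \<alpha> \<Longrightarrow> comp_over P (restr \<beta> T) (restr \<gamma> T) (\<mu> T) \<nu> \<in> carr P (Ob (restr \<gamma> T))"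
    and \<eta>: "\<eta> = comp_over P \<alpha> \<beta> \<xi> \<mu>" and \<zeta>: "\<zeta> = comp_over P \<beta> \<gamma> \<eta> \<nu>"
    and \<zeta>': "\<zeta> = comp_over P \<alpha> \<gamma> \<xi> (\<lambda>T. comp_over P (restr \<beta> T) (restr \<gamma> T) (\<mu> T) \<nu>)"
    by (rule le_left_dec_compose[OF assms(1,2,4,5)]) (rule that)
  have \<eta>_in: "\<eta> \<in> carr P (Ob \<beta>)" unfolding \<eta> using comp_over_in[OF assms(1) ref(1) assms(2) \<mu>] .
  have T: "fin T" using fin_block[OF assms(1) _ assms(3)] ref(1) by (auto simp: refines_def)
  have ref_T: "refines T (restr \<gamma> T) (restr \<beta> T)" using refines_restr[OF ref(1,2) assms(3)] .
  have \<nu>_T: "\<nu> V \<in> carr P (Ob (restr (restr \<gamma> T) V))" if "V \<in> restr \<beta> T" for V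
    using that \<nu> by (simp add: restr_restr restr_def[of \<beta>])
  have psi1: "left_dec_psi P S (\<alpha>, \<xi>) (\<beta>, \<eta>) T = (restr \<beta> T, \<mu> T)"
    using left_dec_psi_eq[OF left_basic assms(1) ref(1) assms(2) \<mu>] assms(3) by (simp add: \<eta>)
  have psi2: "left_dec_psi P S (\<alpha>, \<xi>) (\<gamma>, \<zeta>) T =
      (restr \<gamma> T, comp_over P (restr \<beta> T) (restr \<gamma> T) (\<mu> T) \<nu>)"
    using left_dec_psi_eq[OF left_basic assms(1) ref(3) assms(2) \<mu>\<nu>] assms(3) by (simp add: \<zeta>')
  show "le (left_dec P) T (left_dec_psi P S (\<alpha>, \<xi>) (\<beta>, \<eta>) T) (left_dec_psi P S (\<alpha>, \<xi>) (\<gamma>, \<zeta>) T)"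
    unfolding psi1 psi2 using le_left_decI[OF T ref_T \<nu>_T] by blast
  assume V: "V \<in> restr \<beta> T"
  then have "V \<in> \<beta>" "V \<subseteq> T" by (auto simp: restr_def)
  then show "left_dec_psi P T (left_dec_psi P S (\<alpha>, \<xi>) (\<beta>, \<eta>) T) (left_dec_psi P S (\<alpha>, \<xi>) (\<gamma>, \<zeta>) T) V =
      left_dec_psi P S (\<beta>, \<eta>) (\<gamma>, \<zeta>) V"
    unfolding psi1 psi2 using left_dec_psi_eq[OF left_basic T ref_T \<mu>[OF assms(3)] \<nu>_T]
      left_dec_psi_eq[OF left_basic assms(1) ref(2) \<eta>_in \<nu>] V
    by (simp add: \<zeta> restr_restr)
qed

lemma left_dec_phi_mono:
  assumes "fin S" "refines S \<pi> \<beta>" "\<mu> \<in> carr P (Ob \<alpha>)" "le (left_dec P) S (\<alpha>, \<mu>) (\<beta>, \<nu>)"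
  shows "le (left_dec P) (Ob \<pi>) (left_dec_phi P S (\<pi>, \<xi>) (\<alpha>, \<mu>)) (left_dec_phi P S (\<pi>, \<xi>) (\<beta>, \<nu>))"
  using le_left_dec_transport[OF refinement_iso_quot[OF assms(1,2)] assms(3,4)]
    le_left_dec_refines[OF assms(4)] by simp

text \<open>Both sides transport \<mu> along a composite of two maps on blocks of \<alpha>, and the
  two composites agree.\<close>

lemma left_dec_phi_equivariant:
  assumes "fin S" "bij_betw f S S'" "refines S \<pi> \<alpha>" "\<mu> \<in> carr P (Ob \<alpha>)"
  shows "act (left_dec P) (Ob \<pi>) (on_Ob ((`) f)) (left_dec_phi P S (\<pi>, \<xi>) (\<alpha>, \<mu>)) =
    left_dec_phi P S' (act (left_dec P) S f (\<pi>, \<xi>)) (act (left_dec P) S f (\<alpha>, \<mu>))"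
proof -
  define q where "q = (\<lambda>T. Ob (restr \<pi> T))"
  define q' where "q' = (\<lambda>T. Ob (restr ((`) f ` \<pi>) T))"
  have p: "partition_on S \<alpha>" "partition_on S \<pi>" using assms(3) by (auto simp: refines_def)
  have fin\<alpha>: "finite T" if "T \<in> \<alpha>" for T using finite_block[OF assms(1) p(1)] that .
  have S': "fin S'" using bij_betw_fin assms(1,2) by blast
  have ref': "refines S' ((`) f ` \<pi>) ((`) f ` \<alpha>)" using refines_image assms(2,3) by blast
  have p': "partition_on S' ((`) f ` \<pi>)" using ref' by (simp add: refines_def)
  have finq: "finite (q T)" "finite (q' T)" for T
    using fin_partition[OF assms(1) p(2)] by (auto simp: fin_def q_def q'_def Ob_def restr_def)
  \<comment> \<open>Relabelling the class of T by f gives the class of the image of T.\<close>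
  have comm: "on_Ob ((`) f) ` q T = q' (f ` T)" if "T \<in> \<alpha>" for T
  proof -
    have "T \<subseteq> S" using that p(1) by (auto simp: partition_on_def)
    then have "restr ((`) f ` \<pi>) (f ` T) = (`) f ` restr \<pi> T"
      using restr_image[of f S \<pi> T] assms(2) p(2) by (simp add: bij_betw_def partition_on_def)
    moreover have "finite B" if "B \<in> restr \<pi> T" for B
      using finite_block[OF assms(1) p(2)] that by (simp add: restr_def)
    ultimately show ?thesis
      using on_Ob_image_Ob[of "restr \<pi> T" "(`) f"] by (simp add: q_def q'_def)
  qed
  have injq: "inj_on q \<alpha>" using inj_on_Ob_restr[OF assms(1,3)] by (simp add: q_def)
  have injq': "inj_on q' ((`) f ` \<alpha>)" using inj_on_Ob_restr[OF S' ref'] by (simp add: q'_def)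
  have injf: "inj_on ((`) f) \<alpha>"
    using bij_betw_image_partition[OF assms(2) p(1)] by (simp add: bij_betw_def)
  have inj: "inj_on (\<lambda>T. q' (f ` T)) \<alpha>" using comp_inj_on[OF injf injq'] by (simp add: o_def)
  have injf': "inj_on ((`) (on_Ob ((`) f))) (q ` \<alpha>)" using inj comm by (auto simp: inj_on_def)
  have "act P (Ob (q ` \<alpha>)) (on_Ob ((`) (on_Ob ((`) f)))) (act P (Ob \<alpha>) (on_Ob q) \<mu>) =
    act P (Ob \<alpha>) (on_Ob ((`) (on_Ob ((`) f)) \<circ> q)) \<mu>"
    using finq injq injf' by (intro act_on_Ob_act_on_Ob[OF fin_partition[OF assms(1) p(1)] fin\<alpha> _ _ _ _ assms(4)]) auto
  also have "\<dots> = act P (Ob \<alpha>) (on_Ob (q' \<circ> (`) f)) \<mu>"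
  proof (rule act_on_Ob_cong[OF fin_partition[OF assms(1) p(1)] fin\<alpha> _ _ _ assms(4)])
    show "inj_on ((`) (on_Ob ((`) f)) \<circ> q) \<alpha>" using inj comm by (auto simp: inj_on_def)
  qed (use comm finq in auto)
  also have "\<dots> = act P (Ob ((`) f ` \<alpha>)) (on_Ob q') (act P (Ob \<alpha>) (on_Ob ((`) f)) \<mu>)"
    using finq injq' injf fin\<alpha>
    by (intro act_on_Ob_act_on_Ob[OF fin_partition[OF assms(1) p(1)] fin\<alpha> _ _ _ _ assms(4), symmetric]) auto
  finally have "act P (Ob (q ` \<alpha>)) (on_Ob ((`) (on_Ob ((`) f)))) (act P (Ob \<alpha>) (on_Ob q) \<mu>) =
    act P (Ob ((`) f ` \<alpha>)) (on_Ob q') (act P (Ob \<alpha>) (on_Ob ((`) f)) \<mu>)" .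
  moreover have "(`) (on_Ob ((`) f)) ` q ` \<alpha> = q' ` (`) f ` \<alpha>"
    using comm by (auto simp: image_image)
  ultimately show ?thesis by (simp add: quot_def q_def q'_def)
qed

text \<open>Again two composite relabellings of \<mu>: class by class over the quotient, or first by
  \<beta> and then along the identification of \<beta> with its quotient.\<close>

lemma left_dec_phi_phi:
  assumes "fin S" "refines S \<pi> \<beta>" "refines S \<beta> \<alpha>" "\<mu> \<in> carr P (Ob \<alpha>)"
  shows "left_dec_phi P (Ob \<pi>) (left_dec_phi P S (\<pi>, \<xi>) (\<beta>, \<eta>)) (left_dec_phi P S (\<pi>, \<xi>) (\<alpha>, \<mu>)) =
    act (left_dec P) (Ob \<beta>) (on_Ob (\<lambda>T. Ob (restr \<pi> T))) (left_dec_phi P S (\<beta>, \<eta>) (\<alpha>, \<mu>))"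
proof -
  define q where "q = (\<lambda>T. Ob (restr \<pi> T))"
  define r where "r = (\<lambda>T. Ob (restr \<beta> T))"
  define s where "s = (\<lambda>U. Ob (restr (quot \<beta> \<pi>) U))"
  have ref: "refines S \<pi> \<alpha>" using refines_trans assms(2,3) by blast
  have p: "partition_on S \<alpha>" "partition_on S \<beta>" "partition_on S \<pi>"
    using assms(2,3) by (auto simp: refines_def)
  have fin\<alpha>: "finite T" if "T \<in> \<alpha>" for T using finite_block[OF assms(1) p(1)] that .
  have finq: "finite (q T)" "finite (r T)" for T
    using fin_partition[OF assms(1) p(2)] fin_partition[OF assms(1) p(3)]
    by (auto simp: fin_def q_def r_def Ob_def restr_def)
  have fins: "finite (s U)" for U
    using fin_partition[OF assms(1) p(2)] by (auto simp: fin_def s_def Ob_def restr_def quot_def)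
  \<comment> \<open>Collecting the elements of \<open>quot \<beta> \<pi>\<close> inside the class of
    T amounts to collecting the blocks of \<beta> inside T and passing to their classes.\<close>
  have comm: "s (q T) = on_Ob q ` r T" if "T \<in> \<alpha>" for T
  proof -
    have "finite B" if "B \<in> restr \<beta> T" for B
      using finite_block[OF assms(1) p(2)] that by (simp add: restr_def)
    then show ?thesis
      using restr_quot[OF assms(1-3) that] on_Ob_image_Ob[of "restr \<beta> T" q]
      by (simp add: s_def q_def r_def)
  qed
  have injq: "inj_on q \<alpha>" using inj_on_Ob_restr[OF assms(1) ref] by (simp add: q_def)
  have injr: "inj_on r \<alpha>" using inj_on_Ob_restr[OF assms(1,3)] by (simp add: r_def)
  have injs: "inj_on s (q ` \<alpha>)"
    using inj_on_Ob_restr[OF fin_Ob_partition[OF assms(1) p(3)] refines_quot[OF assms(1-3)]]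
    by (simp add: s_def q_def quot_def)
  have inj: "inj_on (s \<circ> q) \<alpha>" using comp_inj_on[OF injq injs] .
  have injq': "inj_on ((`) (on_Ob q)) (r ` \<alpha>)" using inj comm by (auto simp: inj_on_def)
  have "act P (Ob (q ` \<alpha>)) (on_Ob s) (act P (Ob \<alpha>) (on_Ob q) \<mu>) = act P (Ob \<alpha>) (on_Ob (s \<circ> q)) \<mu>"
    using finq fins injq injs
    by (intro act_on_Ob_act_on_Ob[OF fin_partition[OF assms(1) p(1)] fin\<alpha> _ _ _ _ assms(4)]) auto
  also have "\<dots> = act P (Ob \<alpha>) (on_Ob ((`) (on_Ob q) \<circ> r)) \<mu>"
    using fins
    by (intro act_on_Ob_cong[OF fin_partition[OF assms(1) p(1)] fin\<alpha> _ inj _ assms(4)])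
      (auto simp: comm[symmetric])
  also have "\<dots> = act P (Ob (r ` \<alpha>)) (on_Ob ((`) (on_Ob q))) (act P (Ob \<alpha>) (on_Ob r) \<mu>)"
    using finq(2) injr injq'
    by (intro act_on_Ob_act_on_Ob[OF fin_partition[OF assms(1) p(1)] fin\<alpha> _ _ _ _ assms(4), symmetric]) auto
  finally have "act P (Ob (q ` \<alpha>)) (on_Ob s) (act P (Ob \<alpha>) (on_Ob q) \<mu>) =
    act P (Ob (r ` \<alpha>)) (on_Ob ((`) (on_Ob q))) (act P (Ob \<alpha>) (on_Ob r) \<mu>)" .
  moreover have "s ` q ` \<alpha> = (`) (on_Ob q) ` r ` \<alpha>"
    using comm by (auto simp: image_image)
  ultimately show ?thesis by (simp add: quot_def q_def r_def s_def)
qed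

lemma left_dec_psi_equivariant:
  assumes "fin S" "bij_betw f S S'" "\<xi> \<in> carr P (Ob \<pi>)" "le (left_dec P) S (\<pi>, \<xi>) (\<beta>, \<eta>)" "T \<in> \<pi>"
  shows "act (left_dec P) T f (left_dec_psi P S (\<pi>, \<xi>) (\<beta>, \<eta>) T) =
    left_dec_psi P S' (act (left_dec P) S f (\<pi>, \<xi>)) (act (left_dec P) S f (\<beta>, \<eta>)) (f ` T)"
proof -
  note iso = refinement_iso_image[OF assms(1,2) le_left_dec_refines[OF assms(4)]]
  \<comment> \<open>The action is defined by cases on pairs, so the value of \<psi> has to be
    displayed as a pair before it can be computed.\<close>
  have "left_dec_psi P S (\<pi>, \<xi>) (\<beta>, \<eta>) T = (restr \<beta> T, snd (left_dec_psi P S (\<pi>, \<xi>) (\<beta>, \<eta>) T))"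
    using left_dec_psi_in(2)[OF assms(1,3,4,5)] by (simp add: prod_eq_iff)
  then have "act (left_dec P) T f (left_dec_psi P S (\<pi>, \<xi>) (\<beta>, \<eta>) T) =
    ((`) f ` restr \<beta> T, act P (Ob (restr \<beta> T)) (on_Ob ((`) f)) (snd (left_dec_psi P S (\<pi>, \<xi>) (\<beta>, \<eta>) T)))"
    by (metis act_left_dec)
  then show ?thesis
    using left_dec_psi_transport[OF left_basic iso assms(3,4,5)] iso assms(5)
    by (simp add: refinement_iso_def)
qed

text \<open>The left side is \<psi> transported along the quotient by \<gamma>. The right side is
  the quotient by the part of \<gamma> inside T, which gives the same classes to the blocks of
  \<beta> inside T.\<close>

lemma left_dec_psi_phi:
  assumes "fin S" "\<xi> \<in> carr P (Ob \<alpha>)" "T \<in> \<alpha>"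
    and "le (left_dec P) S (\<alpha>, \<xi>) (\<beta>, \<eta>)" "le (left_dec P) S (\<beta>, \<eta>) (\<gamma>, \<zeta>)"
  shows "left_dec_psi P (Ob \<gamma>) (left_dec_phi P S (\<gamma>, \<zeta>) (\<alpha>, \<xi>)) (left_dec_phi P S (\<gamma>, \<zeta>) (\<beta>, \<eta>))
      (Ob (restr \<gamma> T)) =
    left_dec_phi P T (left_dec_psi P S (\<alpha>, \<xi>) (\<gamma>, \<zeta>) T) (left_dec_psi P S (\<alpha>, \<xi>) (\<beta>, \<eta>) T)"
proof -
  define q where "q = (\<lambda>T. Ob (restr \<gamma> T))"
  define \<mu> where "\<mu> = snd (left_dec_psi P S (\<alpha>, \<xi>) (\<beta>, \<eta>) T)"
  have \<beta>\<alpha>: "refines S \<beta> \<alpha>" and \<gamma>\<beta>: "refines S \<gamma> \<beta>" using assms(4,5) by (blast dest: le_left_dec_refines)+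
  have le: "le (left_dec P) S (\<alpha>, \<xi>) (\<gamma>, \<zeta>)"
    using assms(4,5) by (rule le_left_dec_compose[OF assms(1,2)]) (rule le_left_decI[OF assms(1)])
  have p: "partition_on S \<beta>" using \<gamma>\<beta> by (simp add: refines_def)
  have psi\<beta>: "left_dec_psi P S (\<alpha>, \<xi>) (\<beta>, \<eta>) T = (restr \<beta> T, \<mu>)"
    using left_dec_psi_in(2)[OF assms(1,2,4,3)] by (simp add: \<mu>_def prod_eq_iff)
  have \<mu>: "\<mu> \<in> carr P (Ob (restr \<beta> T))"
    using left_dec_psi_in(1)[OF assms(1,2,4)] assms(3) psi\<beta> by (auto dest!: PiE_mem)
  \<comment> \<open>\<open>left_dec_phi\<close> depends on its base point through the partition
    alone, so any name for the decoration suffices.\<close>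
  obtain \<nu> where psi\<gamma>: "left_dec_psi P S (\<alpha>, \<xi>) (\<gamma>, \<zeta>) T = (restr \<gamma> T, \<nu>)"
    using left_dec_psi_in(2)[OF assms(1,2) le assms(3)] by (metis prod.collapse)
  note iso = refinement_iso_quot[OF assms(1) \<gamma>\<beta> \<beta>\<alpha>]
  have "left_dec_psi P (Ob \<gamma>) (left_dec_phi P S (\<gamma>, \<zeta>) (\<alpha>, \<xi>)) (left_dec_phi P S (\<gamma>, \<zeta>) (\<beta>, \<eta>)) (q T) =
    (q ` restr \<beta> T, act P (Ob (restr \<beta> T)) (on_Ob q) \<mu>)"
    using left_dec_psi_transport[OF left_basic iso assms(2,4,3)] restr_quot[OF assms(1) \<gamma>\<beta> \<beta>\<alpha> assms(3)]
    by (simp add: q_def \<mu>_def)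
  moreover have eq: "Ob (restr (restr \<gamma> T) B) = q B" if "B \<in> restr \<beta> T" for B
    using that by (simp add: q_def restr_restr restr_def[of \<beta>])
  moreover have "quot (restr \<beta> T) (restr \<gamma> T) = q ` restr \<beta> T"
    using eq by (simp add: quot_def)
  \<comment> \<open>The two class maps agree on blocks inside T only, so the actions are identified
    by congruence and not by rewriting the map.\<close>
  moreover have "act P (Ob (restr \<beta> T)) (on_Ob q) \<mu> =
    act P (Ob (restr \<beta> T)) (on_Ob (\<lambda>B. Ob (restr (restr \<gamma> T) B))) \<mu>"
  proof (rule act_on_Ob_cong[OF fin_restr[OF assms(1) \<beta>\<alpha> assms(3)] _ _ _ _ \<mu>])
    show "finite B" if "B \<in> restr \<beta> T" for B using finite_block[OF assms(1) p] that by (simp add: restr_def)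
    show "finite U" if "U \<in> q ` restr \<beta> T" for U
      using that fin_partition[OF assms(1), of \<gamma>] \<gamma>\<beta> by (auto simp: q_def fin_def Ob_def restr_def refines_def)
    show "inj_on q (restr \<beta> T)"
      using inj_on_Ob_restr[OF assms(1) \<gamma>\<beta>] unfolding q_def by (rule inj_on_subset) (simp add: restr_def)
  qed (use eq in auto)
  ultimately show ?thesis by (simp add: psi\<beta> psi\<gamma> q_def)
qed

section \<open>The axioms of an operadic poset species\<close>

lemma operadic_poset_species_left_dec:
  "operadic_poset_species (left_dec P) (\<lambda>S. fst) (left_dec_phi P) (left_dec_psi P)"
proof (rule operadic_poset_species.intro[OF poset_species_left_dec], rule operadic_poset_species_axioms.intro)
  let ?L = "left_dec P"
  show "poset_species_morphism ?L Part (\<lambda>S. fst)"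
    by (auto simp: poset_species_morphism_def Part_def left_dec_def intro!: monotone_onI)
  show "is_singleton (carr ?L {s})" for s
  proof -
    \<comment> \<open>On one point the coarsest and the finest partition coincide, which leaves a
      single partition; its decoration is then the unit.\<close>
    have "refines {s} \<pi> {{s}}" "refines {s} {{s}} \<pi>" if "partition_on {s} \<pi>" for \<pi> :: "'a hf set set"
      using that refines_whole[of "{s}" \<pi>] refines_singletons[of "{s}" \<pi>] by (simp_all add: fin_def)
    then have "partition_on {s} \<pi> \<longleftrightarrow> \<pi> = {{s}}" for \<pi> :: "'a hf set set"
      using partition_on_space[of "{s}"] refines_asym by blast
    then have "x \<in> carr ?L {s} \<longleftrightarrow> x = ({{s}}, unit P (enc {s}))" for x
      by (cases x) (simp add: Ob_def carr_singleton cong: conj_cong)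
    then have "carr ?L {s} = {({{s}}, unit P (enc {s}))}" by blast
    then show ?thesis by simp
  qed
  fix S :: "'a hf set"
  assume S: "fin S"
  \<comment> \<open>The fibre over {S} is decorated by operations on the one point
    \<open>enc S\<close>, so it has a single element.\<close>
  show "{x \<in> carr ?L S. fst x \<in> minimal_elts (carr Part S) (le Part S)} = minimal_elts (carr ?L S) (le ?L S)"
  proof -
    have "partition_on S {S}" "Ob {S} = {enc S}"
      using S by (auto simp: fin_def partition_on_space Ob_def)
    then show ?thesis
      unfolding minimal_elts_left_dec[OF S] minimal_elts_Part[OF S] by (auto simp: carr_singleton)
  qed
  show "{x \<in> carr ?L S. fst x \<in> maximal_elts (carr Part S) (le Part S)} = maximal_elts (carr ?L S) (le ?L S)"
    unfolding maximal_elts_left_dec[OF S] maximal_elts_Part by simp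
  fix x assume x: "x \<in> carr ?L S"
  obtain \<pi> \<xi> where x_def: "x = (\<pi>, \<xi>)" by (cases x)
  have \<pi>: "partition_on S \<pi>" and \<xi>: "\<xi> \<in> carr P (Ob \<pi>)" using x by (simp_all add: x_def)
  have below_refines: "refines S \<pi> \<alpha>" if "(\<alpha>, \<mu>) \<in> below ?L S x" for \<alpha> \<mu>
    using that by (auto simp: below_def x_def dest: le_left_dec_refines)
  show "left_dec_phi P S x \<in> below ?L S x \<rightarrow> carr ?L (Ob (fst x))"
  proof
    fix y assume y: "y \<in> below ?L S x"
    obtain \<alpha> \<mu> where y_def: "y = (\<alpha>, \<mu>)" by (cases y)
    \<comment> \<open>The simp rule for \<phi> is switched off here and below to keep the goal in
      the folded form of the lemma applied.\<close>
    show "left_dec_phi P S x y \<in> carr ?L (Ob (fst x))"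
      using left_dec_phi_in[OF S below_refines[OF y[unfolded y_def]]] y
      by (simp add: below_def x_def y_def del: left_dec_phi_eq)
  qed
  show "monotone_on (below ?L S x) (le ?L S) (le ?L (Ob (fst x))) (left_dec_phi P S x)"
  proof (rule monotone_onI)
    fix y z assume yz: "y \<in> below ?L S x" "z \<in> below ?L S x" "le ?L S y z"
    obtain \<alpha> \<mu> \<beta> \<nu> where eq: "y = (\<alpha>, \<mu>)" "z = (\<beta>, \<nu>)" by (cases y, cases z)
    show "le ?L (Ob (fst x)) (left_dec_phi P S x y) (left_dec_phi P S x z)"
      using yz left_dec_phi_mono[OF S below_refines[OF yz(2)[unfolded eq]]]
      by (simp add: below_def x_def eq del: left_dec_phi_eq)
  qed
  show "left_dec_psi P S x \<in> above ?L S x \<rightarrow> (\<Pi>\<^sub>E T\<in>fst x. carr ?L T)"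
  proof
    fix y assume "y \<in> above ?L S x"
    then show "left_dec_psi P S x y \<in> (\<Pi>\<^sub>E T\<in>fst x. carr ?L T)"
      using left_dec_psi_in(1)[OF S \<xi>] by (cases y) (simp add: above_def x_def)
  qed
  show "monotone_on (above ?L S x) (le ?L S) (\<lambda>u v. \<forall>T\<in>fst x. le ?L T (u T) (v T)) (left_dec_psi P S x)"
  proof (rule monotone_onI)
    fix y z assume yz: "y \<in> above ?L S x" "z \<in> above ?L S x" "le ?L S y z"
    obtain \<alpha> \<mu> \<beta> \<nu> where "y = (\<alpha>, \<mu>)" "z = (\<beta>, \<nu>)" by (cases y, cases z)
    then show "\<forall>T\<in>fst x. le ?L T (left_dec_psi P S x y T) (left_dec_psi P S x z T)"
      using yz left_dec_psi_chain(1)[OF S \<xi>] by (simp add: above_def x_def)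
  qed
  {
    fix y assume "y \<in> below ?L S x"
    then show "fst (left_dec_phi P S x y) = quot (fst y) (fst x)"
      by (cases y) (simp add: x_def)
  }
  {
    fix y T assume "y \<in> above ?L S x" "T \<in> fst x"
    then show "fst (left_dec_psi P S x y T) = restr (fst y) T"
      using left_dec_psi_in(2)[OF S \<xi>] by (cases y) (simp add: above_def x_def)
  }
  {
    fix f :: "'a hf \<Rightarrow> 'a hf" and S' y assume f: "bij_betw f S S'" and y: "y \<in> below ?L S x"
    obtain \<alpha> \<mu> where y_def: "y = (\<alpha>, \<mu>)" by (cases y)
    show "act ?L (Ob (fst x)) (on_Ob ((`) f)) (left_dec_phi P S x y) =
        left_dec_phi P S' (act ?L S f x) (act ?L S f y)"
      using left_dec_phi_equivariant[OF S f below_refines[OF y[unfolded y_def]]] y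
      by (simp add: below_def x_def y_def del: left_dec_phi_eq act_left_dec)
  }
  {
    fix f :: "'a hf \<Rightarrow> 'a hf" and S' y T assume "bij_betw f S S'" "y \<in> above ?L S x" "T \<in> fst x"
    then show "act ?L T f (left_dec_psi P S x y T) =
        left_dec_psi P S' (act ?L S f x) (act ?L S f y) (f ` T)"
      using left_dec_psi_equivariant[OF S _ \<xi>]
      by (cases y) (simp add: above_def x_def del: act_left_dec)
  }
  fix x' assume x': "x' \<in> carr ?L S" and le: "le ?L S x x'"
  obtain \<pi>' \<xi>' where x'_def: "x' = (\<pi>', \<xi>')" by (cases x')
  have ref: "refines S \<pi>' \<pi>" using le le_left_dec_refines by (auto simp: x_def x'_def)
  {
    fix y assume y: "y \<in> below ?L S x"
    obtain \<alpha> \<mu> where y_def: "y = (\<alpha>, \<mu>)" by (cases y)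
    show "left_dec_phi P (Ob (fst x')) (left_dec_phi P S x' x) (left_dec_phi P S x' y) =
        act ?L (Ob (fst x)) (on_Ob (\<lambda>T. Ob (restr (fst x') T))) (left_dec_phi P S x y)"
      using left_dec_phi_phi[OF S ref below_refines[OF y[unfolded y_def]]] y
      by (simp add: below_def x_def x'_def y_def del: left_dec_phi_eq act_left_dec)
  }
  {
    fix y T V assume "y \<in> above ?L S x'" "T \<in> fst x" "V \<in> restr (fst x') T"
    then show "left_dec_psi P T (left_dec_psi P S x x' T) (left_dec_psi P S x y T) V = left_dec_psi P S x' y V"
      using left_dec_psi_chain(2)[OF S \<xi>] le by (cases y) (simp add: above_def x_def x'_def)
  }
  {
    fix y T assume "y \<in> above ?L S x" "y \<in> below ?L S x'" "T \<in> fst x"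
    then show "left_dec_psi P (Ob (fst x')) (left_dec_phi P S x' x) (left_dec_phi P S x' y)
        (Ob (restr (fst x') T)) = left_dec_phi P T (left_dec_psi P S x x' T) (left_dec_psi P S x y T)"
      using left_dec_psi_phi[OF S \<xi>]
      by (cases y) (simp add: above_def below_def x_def x'_def del: left_dec_phi_eq)
  }
qed

end

theorem proposition3p5:
  fixes P :: "('a hf, 'o) operad_data"
  assumes "set_operad P"
    and "left_basic P"
    and "\<And>S. finite S \<Longrightarrow> finite (carr P S)"
    and "carr P {} = {}"
    and "\<And>s. carr P {s} = {unit P s}"
    and "\<And>S. fin S \<Longrightarrow> carr P S \<noteq> {}"
  shows "operadic_poset_species (left_dec P) (\<lambda>S. fst) (left_dec_phi P) (left_dec_psi P)"
proof -
  interpret left_basic_operad P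
    using assms by (intro left_basic_operad.intro left_basic_operad_axioms.intro)
  show ?thesis by (rule operadic_poset_species_left_dec)
qed

end
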